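(* Let $f:\mathbb{R}^2\to\mathbb{R}$, $(u^2,u^3)\mapsto f(u^2,u^3)$, be a smooth nowhere vanishing function and let $G$ be the semi-Riemannian metric for the Lie-Rinehart algebra $(\mathfrak{X}^\infty(\mathcal{X}),\mathcal{C}^\infty(\mathcal{X}))$ determined on the free generators $\zeta_1,\zeta_2$ by $$G(\zeta_1,\zeta_1)=-u^2f,\qquad G(\zeta_1,\zeta_2)=G(\zeta_2,\zeta_1)=\tfrac92u^3f,\qquad G(\zeta_2,\zeta_2)=3(u^2)^2f.$$ Then there is a Levi-Civita connection $\nabla$ of $G$, i.e. a metric torsion-free $\mathfrak{X}^\infty(\mathcal{X})$-connection on $\mathfrak{X}^\infty(\mathcal{X})$. Writing $\partial_2=\partial/\partial u^2$, $\partial_3=\partial/\partial u^3$ and $\nabla_{\zeta_i}\zeta_j=\sum_k\Gamma_{ij}^k\zeta_k$, the matrices $\Gamma_i$ of its Christoffel symbols, with $\Gamma_{ij}^k$ in row $k$ and column $j$, are $$\Gamma_1=\begin{bmatrix}1+u^2\partial_2(\log f)+3u^3\partial_3(\log f)&(u^2)^2\partial_3(\log f)\\ \tfrac13u^2\partial_3(\log f)&2+u^2\partial_2(\log f)\end{bmatrix},$$ $$\Gamma_2=\begin{bmatrix}(u^2)^2\partial_3(\log f)&3u^2\bigl(-2+u^2\partial_2(\log f)\bigr)\\ 1+u^2\partial_2(\log f)&-9u^3\partial_2(\log f)+(u^2)^2\partial_3(\log f)\end{bmatrix}.$$ Its curvature endomorphism is given by $$\mathcal{R}(\zeta_1,\zeta_2)\zeta_1=\bigl(-3(u^2)^2u^3\chi+9u^3\lambda\bigr)\zeta_1+\bigl(-\tfrac23(u^2)^3\chi+2u^2\lambda\bigr)\zeta_2,$$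 $$\mathcal{R}(\zeta_1,\zeta_2)\zeta_2=\bigl(-2(u^2)^4\chi+6(u^2)^2\lambda\bigr)\zeta_1+\bigl(3(u^2)^2u^3\chi-9u^3\lambda\bigr)\zeta_2,$$ where $$\chi=\partial_3\partial_3(\log f),\qquad \lambda=\partial_2(\log f)+3u^3\,\partial_2\partial_3(\log f)+u^2\,\partial_2\partial_2(\log f).$$ In the special case when $f$ is constant, $\nabla$ is flat.
   Context: Upper indices on $u$ label coordinates: $u^2,u^3$ are the coordinates of $\mathbb{R}^2$, and powers are written $(u^2)^m$. Put $\Delta=4(u^2)^3+27(u^3)^2$ and $\mathcal{X}=\{(u^2,u^3)\in\mathbb{R}^2\mid\Delta\le0\}$ (the image of the orbit space $V/\Sigma_3$, $V=\{x\in\mathbb{R}^3\mid\sum_ix^i=0\}$, under the second and third elementary symmetric functions). $\mathcal{C}^\infty(\mathcal{X})$ is the algebra of restrictions to $\mathcal{X}$ of smooth functions on $\mathbb{R}^2$. The stratum closures of $\mathcal{X}$ are $\mathcal{X}$, $\{\Delta=0\}$ and $\{0\}$; $\mathfrak{X}^\infty(\mathcal{X})$ is the set of derivations $X$ of $\mathcal{C}^\infty(\mathcal{X})$ such that $X(\mathcal{I})\subseteq\mathcal{I}$ for the vanishing ideal $\mathcal{I}\subseteq\mathcal{C}^\infty(\mathcal{X})$ of each stratum closure. It is a Lie algebra under the commutator and is a free $\mathcal{C}^\infty(\mathcal{X})$-module with basis $$\zeta_1=2u^2\frac{\partial}{\partial u^2}+3u^3\frac{\partial}{\partial u^3},\qquad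 \zeta_2=-9u^3\frac{\partial}{\partial u^2}+2(u^2)^2\frac{\partial}{\partial u^3}.$$ Write $A=\mathcal{C}^\infty(\mathcal{X})$, $L=\mathfrak{X}^\infty(\mathcal{X})$. A semi-Riemannian metric for $(L,A)$ is a symmetric $A$-bilinear form $G:L\times L\to A$ such that $X\mapsto G(X,\cdot)$ is injective $L\to\operatorname{Hom}_A(L,A)$. An $L$-connection on $L$ is an $A$-linear assignment $X\mapsto\nabla_X\in\operatorname{End}_{\mathbb{R}}(L)$ with $\nabla_X(aY)=X(a)Y+a\nabla_XY$. It is metric if $X(G(Y,Z))=G(\nabla_XY,Z)+G(Y,\nabla_XZ)$, torsion-free if $\nabla_XY-\nabla_YX=[X,Y]$, and flat if its curvature endomorphism $\mathcal{R}(X,Y)=[\nabla_X,\nabla_Y]-\nabla_{[X,Y]}$ vanishes. Derivatives of $\log f$ are understood via $\partial_i(\log f)=(\partial_if)/f$ (equivalently $\log|f|$). *)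

theory Defs
  imports "HOL-Analysis.Analysis"
begin

section \<open>Smooth functions on the plane\<close>

text \<open>A point of the plane is a pair \<open>(u\<^sup>2, u\<^sup>3)\<close>; upper indices are labels, not powers.\<close>

type_synonym plane = "real \<times> real"

fun Ck :: "nat \<Rightarrow> (plane \<Rightarrow> real) \<Rightarrow> bool" where
  "Ck 0 F \<longleftrightarrow> continuous_on UNIV F"
| "Ck (Suc k) F \<longleftrightarrow> (\<forall>p. F differentiable (at p)) \<and> (\<forall>v. Ck k (\<lambda>p. frechet_derivative F (at p) v))"

definition smooth :: "(plane \<Rightarrow> real) \<Rightarrow> bool" where
  "smooth F \<longleftrightarrow> (\<forall>k. Ck k F)"

definition pd2 :: "(plane \<Rightarrow> real) \<Rightarrow> plane \<Rightarrow> real" where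
  "pd2 F p = frechet_derivative F (at p) (1, 0)"

definition pd3 :: "(plane \<Rightarrow> real) \<Rightarrow> plane \<Rightarrow> real" where
  "pd3 F p = frechet_derivative F (at p) (0, 1)"

lemma smooth_differentiable: "smooth F \<Longrightarrow> F differentiable (at p)"
  unfolding smooth_def by (metis Ck.simps(2))

lemma smooth_has_derivative:
  "smooth F \<Longrightarrow> (F has_derivative frechet_derivative F (at p)) (at p)"
  using smooth_differentiable frechet_derivative_works by blast

lemma smooth_frechet: "smooth F \<Longrightarrow> smooth (\<lambda>p. frechet_derivative F (at p) v)"
  unfolding smooth_def by (metis Ck.simps(2))

lemma smooth_continuous_on: "smooth F \<Longrightarrow> continuous_on S F"
  unfolding smooth_def by (metis Ck.simps(1) continuous_on_subset subset_UNIV)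

lemma smooth_pd: "smooth F \<Longrightarrow> smooth (pd2 F)" "smooth F \<Longrightarrow> smooth (pd3 F)"
  unfolding pd2_def pd3_def by (simp_all add: smooth_frechet)

lemma frechet_eq_pd:
  assumes "smooth F"
  shows "frechet_derivative F (at p) (a, b) = a * pd2 F p + b * pd3 F p"
proof -
  have l: "linear (frechet_derivative F (at p))"
    using smooth_has_derivative[OF assms] has_derivative_linear by blast
  have "(a, b) = a *\<^sub>R (1, 0) + b *\<^sub>R (0, 1 :: real)"
    by simp
  then show ?thesis
    unfolding pd2_def pd3_def using linear_add[OF l] linear_scale[OF l]
    by (metis real_scaleR_def)
qed

lemma Ck_const: "Ck k (\<lambda>p. c)"
proof (induction k arbitrary: c)
  case (Suc k)
  then show ?case by (simp add: frechet_derivative_const)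
qed simp

lemma smooth_const: "smooth (\<lambda>p. c)"
  by (simp add: smooth_def Ck_const)

lemma smooth_fst: "smooth fst" and smooth_snd: "smooth snd"
proof -
  have "Ck k fst" for k
  proof (cases k)
    case (Suc n)
    have "(fst has_derivative fst) (at p)" for p :: plane
      by (rule has_derivative_fst[OF has_derivative_ident])
    moreover from this have "frechet_derivative fst (at p) = fst" for p :: plane
      using frechet_derivative_at by metis
    ultimately show ?thesis
      using Suc Ck_const unfolding Suc Ck.simps(2) differentiable_def by auto
  qed (simp add: continuous_on_fst)
  then show "smooth fst" by (simp add: smooth_def)
  have "Ck k snd" for k
  proof (cases k)
    case (Suc n)
    have "(snd has_derivative snd) (at p)" for p :: plane
      by (rule has_derivative_snd[OF has_derivative_ident])
    moreover from this have "frechet_derivative snd (at p) = snd" for p :: plane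
      using frechet_derivative_at by metis
    ultimately show ?thesis
      using Suc Ck_const unfolding Suc Ck.simps(2) differentiable_def by auto
  qed (simp add: continuous_on_snd)
  then show "smooth snd" by (simp add: smooth_def)
qed

lemma Ck_Suc_imp: "Ck (Suc k) F \<Longrightarrow> Ck k F"
proof (induction k arbitrary: F)
  case 0
  then show ?case
    by (simp add: continuous_at_imp_continuous_on differentiable_imp_continuous_within)
next
  case (Suc k)
  have "F differentiable (at p)" for p
    using Suc.prems by (simp only: Ck.simps(2))
  moreover have "Ck k (\<lambda>p. frechet_derivative F (at p) v)" for v
  proof (rule Suc.IH)
    show "Ck (Suc k) (\<lambda>p. frechet_derivative F (at p) v)"
      using Suc.prems Ck.simps(2)[of "Suc k" F] by blast
  qed
  ultimately show ?case
    by (simp only: Ck.simps(2)) blast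
qed

lemma frechet_add:
  fixes F H :: "plane \<Rightarrow> real"
  assumes "F differentiable (at p)" "H differentiable (at p)"
  shows "frechet_derivative (\<lambda>q. F q + H q) (at p) v
    = frechet_derivative F (at p) v + frechet_derivative H (at p) v"
proof -
  have "((\<lambda>q. F q + H q) has_derivative
      (\<lambda>v. frechet_derivative F (at p) v + frechet_derivative H (at p) v)) (at p)"
    using assms frechet_derivative_works by (blast intro: has_derivative_add)
  from frechet_derivative_at[OF this] show ?thesis by metis
qed

lemma frechet_mult:
  fixes F H :: "plane \<Rightarrow> real"
  assumes "F differentiable (at p)" "H differentiable (at p)"
  shows "frechet_derivative (\<lambda>q. F q * H q) (at p) v
    = F p * frechet_derivative H (at p) v + frechet_derivative F (at p) v * H p"
proof -
  have "((\<lambda>q. F q * H q) has_derivative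
      (\<lambda>v. F p * frechet_derivative H (at p) v + frechet_derivative F (at p) v * H p)) (at p)"
    using assms frechet_derivative_works by (blast intro: has_derivative_mult)
  from frechet_derivative_at[OF this] show ?thesis by metis
qed

lemma Ck_add: "Ck k F \<Longrightarrow> Ck k H \<Longrightarrow> Ck k (\<lambda>p. F p + H p)"
proof (induction k arbitrary: F H)
  case (Suc k)
  have F: "\<And>p. F differentiable (at p)" "\<And>v. Ck k (\<lambda>p. frechet_derivative F (at p) v)"
    and H: "\<And>p. H differentiable (at p)" "\<And>v. Ck k (\<lambda>p. frechet_derivative H (at p) v)"
    using Suc.prems unfolding Ck.simps by blast+
  show ?case
    unfolding Ck.simps by (simp add: frechet_add Suc.IH F H differentiable_add)
qed (simp add: continuous_on_add)

lemma Ck_mult: "Ck k F \<Longrightarrow> Ck k H \<Longrightarrow> Ck k (\<lambda>p. F p * H p)"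
proof (induction k arbitrary: F H)
  case (Suc k)
  have F: "\<And>p. F differentiable (at p)" "\<And>v. Ck k (\<lambda>p. frechet_derivative F (at p) v)"
    and H: "\<And>p. H differentiable (at p)" "\<And>v. Ck k (\<lambda>p. frechet_derivative H (at p) v)"
    using Suc.prems unfolding Ck.simps by blast+
  have k: "Ck k F" "Ck k H"
    using Suc.prems Ck_Suc_imp by blast+
  show ?case
    unfolding Ck.simps by (simp add: frechet_mult Ck_add Suc.IH k F H differentiable_mult)
qed (simp add: continuous_on_mult)

lemma smooth_add: "smooth F \<Longrightarrow> smooth H \<Longrightarrow> smooth (\<lambda>p. F p + H p)"
  by (simp add: smooth_def Ck_add)

lemma smooth_mult: "smooth F \<Longrightarrow> smooth H \<Longrightarrow> smooth (\<lambda>p. F p * H p)"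
  by (simp add: smooth_def Ck_mult)

lemma smooth_minus: "smooth F \<Longrightarrow> smooth (\<lambda>p. - F p)"
  using smooth_mult[OF smooth_const[of "-1"]] by simp

lemma smooth_diff: "smooth F \<Longrightarrow> smooth H \<Longrightarrow> smooth (\<lambda>p. F p - H p)"
  using smooth_add[OF _ smooth_minus] by simp

lemma smooth_power: "smooth F \<Longrightarrow> smooth (\<lambda>p. F p ^ n)"
  by (induction n) (simp_all add: smooth_const smooth_mult)

lemmas smooth_intros =
  smooth_const smooth_fst smooth_snd smooth_add smooth_mult smooth_minus smooth_diff smooth_power
  smooth_pd

lemma pd_add:
  assumes "smooth F" "smooth H"
  shows "pd2 (\<lambda>p. F p + H p) p = pd2 F p + pd2 H p" "pd3 (\<lambda>p. F p + H p) p = pd3 F p + pd3 H p"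
  using assms by (simp_all add: pd2_def pd3_def frechet_add smooth_differentiable)

lemma pd_mult:
  assumes "smooth F" "smooth H"
  shows "pd2 (\<lambda>p. F p * H p) p = F p * pd2 H p + pd2 F p * H p"
    "pd3 (\<lambda>p. F p * H p) p = F p * pd3 H p + pd3 F p * H p"
  using assms by (simp_all add: pd2_def pd3_def frechet_mult smooth_differentiable)

lemma pd_const: "pd2 (\<lambda>p. c) p = 0" "pd3 (\<lambda>p. c) p = 0"
  by (simp_all add: pd2_def pd3_def frechet_derivative_const)


section \<open>The differential space \<open>\<X>\<close> and the algebra \<open>\<C>\<^sup>\<infinity>(\<X>)\<close>\<close>

definition discr :: "plane \<Rightarrow> real" where
  "discr = (\<lambda>(u2, u3). 4 * u2 ^ 3 + 27 * u3 ^ 2)"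

definition XX :: "plane set" where
  "XX = {p. discr p \<le> 0}"

definition stratum_closures :: "plane set set" where
  "stratum_closures = {XX, {p. discr p = 0}, {(0, 0)}}"

typedef cinf = "{restrict F XX | F. smooth F}"
  morphisms cval Abs_cinf
  using smooth_const by blast

setup_lifting type_definition_cinf

lemma zero_in_XX: "(0, 0) \<in> XX"
  by (simp add: XX_def discr_def)

lemma restrict_in_cinf: "smooth F \<Longrightarrow> restrict F XX \<in> {restrict F XX | F. smooth F}"
  by blast

text \<open>The restriction to \<open>\<X>\<close> of a function on the plane (meaningful for smooth functions only).\<close>

definition cinf_of :: "(plane \<Rightarrow> real) \<Rightarrow> cinf" where
  "cinf_of F = Abs_cinf (restrict F XX)"

lemma cval_cinf_of: "smooth F \<Longrightarrow> cval (cinf_of F) = restrict F XX"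
  unfolding cinf_of_def by (rule Abs_cinf_inverse[OF restrict_in_cinf])

lemma cval_cinf_of_at [simp]: "smooth F \<Longrightarrow> p \<in> XX \<Longrightarrow> cval (cinf_of F) p = F p"
  by (simp add: cval_cinf_of)

lemma ex_cinf_of: "\<exists>F. smooth F \<and> cinf_of F = a"
  using Abs_cinf_cases[of a] unfolding cinf_of_def by auto

lemma cinf_eqI:
  assumes "\<And>p. p \<in> XX \<Longrightarrow> cval a p = cval b p"
  shows "a = b"
proof -
  obtain F H where "smooth F" "cinf_of F = a" "smooth H" "cinf_of H = b"
    using ex_cinf_of by metis
  then have "cval a = cval b"
    using assms by (auto simp: cval_cinf_of restrict_def fun_eq_iff)
  then show ?thesis by (simp add: cval_inject)
qed

instantiation cinf :: "{comm_ring_1, real_algebra_1}"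
begin

lift_definition zero_cinf :: cinf is "restrict (\<lambda>p. 0) XX"
  using smooth_const by blast

lift_definition one_cinf :: cinf is "restrict (\<lambda>p. 1) XX"
  using smooth_const by blast

lift_definition plus_cinf :: "cinf \<Rightarrow> cinf \<Rightarrow> cinf" is
  "\<lambda>a b. restrict (\<lambda>p. a p + b p) XX"
proof -
  fix a b :: "plane \<Rightarrow> real"
  assume "\<exists>F. a = restrict F XX \<and> smooth F" "\<exists>F. b = restrict F XX \<and> smooth F"
  then obtain F H where "smooth F" "smooth H" "a = restrict F XX" "b = restrict H XX"
    by blast
  moreover from this have "restrict (\<lambda>p. a p + b p) XX = restrict (\<lambda>p. F p + H p) XX"
    by (auto simp: fun_eq_iff restrict_def)
  ultimately show "\<exists>F. restrict (\<lambda>p. a p + b p) XX = restrict F XX \<and> smooth F"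
    using smooth_add by blast
qed

lift_definition uminus_cinf :: "cinf \<Rightarrow> cinf" is "\<lambda>a. restrict (\<lambda>p. - a p) XX"
proof -
  fix a :: "plane \<Rightarrow> real"
  assume "\<exists>F. a = restrict F XX \<and> smooth F"
  then obtain F where "smooth F" "a = restrict F XX"
    by blast
  moreover from this have "restrict (\<lambda>p. - a p) XX = restrict (\<lambda>p. - F p) XX"
    by (auto simp: fun_eq_iff restrict_def)
  ultimately show "\<exists>F. restrict (\<lambda>p. - a p) XX = restrict F XX \<and> smooth F"
    using smooth_minus by blast
qed

definition minus_cinf :: "cinf \<Rightarrow> cinf \<Rightarrow> cinf" where
  "minus_cinf a b = a + - b"

lift_definition times_cinf :: "cinf \<Rightarrow> cinf \<Rightarrow> cinf" is
  "\<lambda>a b. restrict (\<lambda>p. a p * b p) XX"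
proof -
  fix a b :: "plane \<Rightarrow> real"
  assume "\<exists>F. a = restrict F XX \<and> smooth F" "\<exists>F. b = restrict F XX \<and> smooth F"
  then obtain F H where "smooth F" "smooth H" "a = restrict F XX" "b = restrict H XX"
    by blast
  moreover from this have "restrict (\<lambda>p. a p * b p) XX = restrict (\<lambda>p. F p * H p) XX"
    by (auto simp: fun_eq_iff restrict_def)
  ultimately show "\<exists>F. restrict (\<lambda>p. a p * b p) XX = restrict F XX \<and> smooth F"
    using smooth_mult by blast
qed

lift_definition scaleR_cinf :: "real \<Rightarrow> cinf \<Rightarrow> cinf" is
  "\<lambda>r a. restrict (\<lambda>p. r * a p) XX"
proof -
  fix r :: real and a :: "plane \<Rightarrow> real"
  assume "\<exists>F. a = restrict F XX \<and> smooth F"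
  then obtain F where "smooth F" "a = restrict F XX"
    by blast
  moreover from this have "restrict (\<lambda>p. r * a p) XX = restrict (\<lambda>p. r * F p) XX"
    by (auto simp: fun_eq_iff restrict_def)
  ultimately show "\<exists>F. restrict (\<lambda>p. r * a p) XX = restrict F XX \<and> smooth F"
    using smooth_mult[OF smooth_const] by blast
qed

lemma cval_simps [simp]:
  assumes "p \<in> XX"
  shows "cval 0 p = 0" "cval 1 p = 1" "cval (a + b) p = cval a p + cval b p"
    "cval (- a) p = - cval a p" "cval (a - b) p = cval a p - cval b p"
    "cval (a * b) p = cval a p * cval b p" "cval (r *\<^sub>R a) p = r * cval a p"
  using assms
  by (simp_all add: zero_cinf.rep_eq one_cinf.rep_eq plus_cinf.rep_eq uminus_cinf.rep_eq
      minus_cinf_def times_cinf.rep_eq scaleR_cinf.rep_eq)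

instance
proof
  show "(0 :: cinf) \<noteq> 1"
    using zero_in_XX cval_simps(1,2) by (metis zero_neq_one)
qed (auto intro!: cinf_eqI simp: algebra_simps)

end

lemma cval_numeral [simp]: "p \<in> XX \<Longrightarrow> cval (numeral n) p = numeral n"
  by (induction n) (simp_all only: numeral.simps cval_simps)

lemma cval_power [simp]: "p \<in> XX \<Longrightarrow> cval (a ^ n) p = cval a p ^ n"
  by (induction n) simp_all

definition vanishing_ideal :: "plane set \<Rightarrow> cinf set" where
  "vanishing_ideal S = {a. \<forall>p\<in>S. cval a p = 0}"

definition U2 :: cinf where "U2 = cinf_of fst"
definition U3 :: cinf where "U3 = cinf_of snd"

text \<open>The operators \<open>\<partial>/\<partial>u\<^sup>2\<close> and \<open>\<partial>/\<partial>u\<^sup>3\<close> on \<open>\<C>\<^sup>\<infinity>(\<X>)\<close>. They differentiate an arbitrary smooth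
  extension; by \<open>dd_cinf_of\<close> below the choice does not matter, since \<open>\<X>\<close> is the closure of its
  interior.\<close>

definition ext_of :: "cinf \<Rightarrow> plane \<Rightarrow> real" where
  "ext_of a = (SOME F. smooth F \<and> cinf_of F = a)"

definition dd2 :: "cinf \<Rightarrow> cinf" where "dd2 a = cinf_of (pd2 (ext_of a))"
definition dd3 :: "cinf \<Rightarrow> cinf" where "dd3 a = cinf_of (pd3 (ext_of a))"

lemma ext_of: "smooth (ext_of a)" "cinf_of (ext_of a) = a"
  using someI_ex[OF ex_cinf_of[of a]] by (simp_all add: ext_of_def)

lemma continuous_discr: "continuous_on S discr"
  unfolding discr_def case_prod_beta by (intro continuous_intros)

lemma cube_inj: "x ^ 3 = y ^ 3 \<Longrightarrow> x = y" for x y :: real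
  by (metis odd_numeral odd_real_root_power_cancel)

lemma cube_less: "x < y \<Longrightarrow> x ^ 3 < y ^ 3" for x y :: real
  by (metis less_le odd_numeral power_mono_odd cube_inj)

lemma XX_subset_closure: "XX \<subseteq> closure {p. discr p < 0}"
proof
  fix p assume p: "p \<in> XX"
  define s where "s n = (fst p - inverse (real (Suc n)), snd p)" for n
  have "discr (s n) < 0" for n
  proof -
    have "(fst p - inverse (real (Suc n))) ^ 3 < fst p ^ 3"
      by (intro cube_less) (simp del: of_nat_Suc)
    then show ?thesis
      using p by (simp add: XX_def discr_def s_def case_prod_beta del: of_nat_Suc)
  qed
  moreover have "s \<longlonglongrightarrow> p"
  proof -
    have "s \<longlonglongrightarrow> (fst p - 0, snd p)"
      unfolding s_def by (intro tendsto_intros LIMSEQ_inverse_real_of_nat)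
    then show ?thesis by simp
  qed
  ultimately show "p \<in> closure {p. discr p < 0}"
    unfolding closure_sequential by blast
qed

lemma frechet_zero_on_XX:
  assumes F: "smooth F" and 0: "\<And>p. p \<in> XX \<Longrightarrow> F p = 0" and p: "p \<in> XX"
  shows "frechet_derivative F (at p) v = 0"
proof -
  let ?U = "{p. discr p < 0}"
  have "open ?U"
    using open_Collect_less[OF continuous_discr continuous_on_const] .
  have "frechet_derivative F (at q) v = 0" if "q \<in> ?U" for q
  proof -
    have "((\<lambda>q. 0 :: real) has_derivative (\<lambda>v. 0)) (at q)"
      by (rule has_derivative_const)
    then have "(F has_derivative (\<lambda>v. 0)) (at q)"
      by (rule has_derivative_transform_within_open[OF _ \<open>open ?U\<close> that])
        (use 0 in \<open>auto simp: XX_def\<close>)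
    then show ?thesis
      using frechet_derivative_at by metis
  qed
  moreover have "continuous_on (closure ?U) (\<lambda>p. frechet_derivative F (at p) v)"
    using smooth_frechet[OF F] by (rule smooth_continuous_on)
  ultimately show ?thesis
    using continuous_constant_on_closure[of ?U "\<lambda>p. frechet_derivative F (at p) v" 0 p]
      XX_subset_closure p by blast
qed

lemma pd_cong_XX:
  assumes "smooth F" "smooth H" "\<And>p. p \<in> XX \<Longrightarrow> F p = H p" "p \<in> XX"
  shows "pd2 F p = pd2 H p" "pd3 F p = pd3 H p"
proof -
  have s: "smooth (\<lambda>p. - 1 * H p)" "smooth (\<lambda>p. F p + - 1 * H p)"
    using assms by (auto intro!: smooth_intros)
  have "frechet_derivative (\<lambda>p. F p + - 1 * H p) (at p) v = 0" for v
    by (rule frechet_zero_on_XX[OF s(2)]) (use assms in auto)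
  then have "pd2 (\<lambda>p. F p + - 1 * H p) p = 0" "pd3 (\<lambda>p. F p + - 1 * H p) p = 0"
    by (auto simp: pd2_def pd3_def)
  then show "pd2 F p = pd2 H p" "pd3 F p = pd3 H p"
    using pd_add[OF assms(1) s(1)] pd_mult[OF smooth_const assms(2), of "- 1"]
    by (simp_all add: pd_const)
qed

lemma dd_cinf_of:
  assumes "smooth F"
  shows "dd2 (cinf_of F) = cinf_of (pd2 F)" "dd3 (cinf_of F) = cinf_of (pd3 F)"
proof -
  have "ext_of (cinf_of F) p = F p" if "p \<in> XX" for p
    using ext_of[of "cinf_of F"] assms that by (metis cval_cinf_of_at)
  note * = pd_cong_XX[OF ext_of(1) assms this]
  show "dd2 (cinf_of F) = cinf_of (pd2 F)" "dd3 (cinf_of F) = cinf_of (pd3 F)"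
    unfolding dd2_def dd3_def
    by (rule cinf_eqI; simp add: smooth_intros ext_of assms *)+
qed


section \<open>The Lie--Rinehart algebra \<open>(\<XX>\<^sup>\<infinity>(\<X>), \<C>\<^sup>\<infinity>(\<X>))\<close>\<close>

definition derivation :: "(cinf \<Rightarrow> cinf) \<Rightarrow> bool" where
  "derivation D \<longleftrightarrow> linear D \<and> (\<forall>a b. D (a * b) = D a * b + a * D b)"

definition is_vfield :: "(cinf \<Rightarrow> cinf) \<Rightarrow> bool" where
  "is_vfield D \<longleftrightarrow> derivation D \<and>
     (\<forall>S\<in>stratum_closures. D ` vanishing_ideal S \<subseteq> vanishing_ideal S)"

lemma stratum_closure_subset: "S \<in> stratum_closures \<Longrightarrow> S \<subseteq> XX"
  by (auto simp: stratum_closures_def XX_def discr_def)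

lemma is_vfieldI:
  assumes "\<And>a b. D (a + b) = D a + D b" "\<And>r a. D (r *\<^sub>R a) = r *\<^sub>R D a"
    and "\<And>a b. D (a * b) = D a * b + a * D b"
    and "\<And>S a p. S \<in> stratum_closures \<Longrightarrow> a \<in> vanishing_ideal S \<Longrightarrow> p \<in> S \<Longrightarrow> cval (D a) p = 0"
  shows "is_vfield D"
  using assms unfolding is_vfield_def derivation_def
  by (auto intro!: linearI simp: vanishing_ideal_def)

lemma is_vfieldD:
  assumes "is_vfield D"
  shows "D (a + b) = D a + D b" "D (r *\<^sub>R a) = r *\<^sub>R D a" "D (a * b) = D a * b + a * D b"
    "D (- a) = - D a" "D (a - b) = D a - D b"
    "S \<in> stratum_closures \<Longrightarrow> \<forall>p\<in>S. cval a p = 0 \<Longrightarrow> p \<in> S \<Longrightarrow> cval (D a) p = 0"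
proof -
  have l: "linear D"
    using assms by (simp add: is_vfield_def derivation_def)
  show "D (a + b) = D a + D b" "D (r *\<^sub>R a) = r *\<^sub>R D a" "D (- a) = - D a" "D (a - b) = D a - D b"
    using l by (simp_all add: linear_add linear_scale linear_neg linear_diff)
  show "D (a * b) = D a * b + a * D b"
    using assms by (simp add: is_vfield_def derivation_def)
  assume "S \<in> stratum_closures" "\<forall>p\<in>S. cval a p = 0" "p \<in> S"
  then show "cval (D a) p = 0"
    using assms unfolding is_vfield_def vanishing_ideal_def by blast
qed

lemma is_vfield_zero: "is_vfield (\<lambda>a. 0)"
proof (rule is_vfieldI)
  fix S :: "plane set" and p assume "S \<in> stratum_closures" "p \<in> S"
  then show "cval 0 p = 0"
    using stratum_closure_subset cval_simps(1) by blast
qed simp_all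

lifting_forget cinf.lifting

typedef vfield = "{D. is_vfield D}"
  morphisms vapp Abs_vfield
  using is_vfield_zero by blast

setup_lifting type_definition_vfield

lemma vfield_eqI: "(\<And>a. vapp X a = vapp Y a) \<Longrightarrow> X = Y"
  by (metis ext vapp_inject)

instantiation vfield :: real_vector
begin

lift_definition zero_vfield :: vfield is "\<lambda>a. 0"
  by (rule is_vfield_zero)

lift_definition plus_vfield :: "vfield \<Rightarrow> vfield \<Rightarrow> vfield" is "\<lambda>D E a. D a + E a"
proof -
  fix D E assume DE: "is_vfield D" "is_vfield E"
  show "is_vfield (\<lambda>a. D a + E a)"
  proof (rule is_vfieldI)
    fix S a p assume "S \<in> stratum_closures" "a \<in> vanishing_ideal S" "p \<in> S"
    then show "cval (D a + E a) p = 0"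
      using is_vfieldD(6)[OF DE(1), of S a p] is_vfieldD(6)[OF DE(2), of S a p]
        stratum_closure_subset[of S] by (auto simp: vanishing_ideal_def)
  qed (simp_all add: is_vfieldD(1-3)[OF DE(1)] is_vfieldD(1-3)[OF DE(2)] algebra_simps)
qed

lift_definition uminus_vfield :: "vfield \<Rightarrow> vfield" is "\<lambda>D a. - D a"
proof -
  fix D assume D: "is_vfield D"
  show "is_vfield (\<lambda>a. - D a)"
  proof (rule is_vfieldI)
    fix S a p assume "S \<in> stratum_closures" "a \<in> vanishing_ideal S" "p \<in> S"
    then show "cval (- D a) p = 0"
      using is_vfieldD(6)[OF D, of S a p] stratum_closure_subset[of S]
      by (auto simp: vanishing_ideal_def)
  qed (simp_all add: is_vfieldD(1-3)[OF D] algebra_simps)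
qed

definition minus_vfield :: "vfield \<Rightarrow> vfield \<Rightarrow> vfield" where
  "minus_vfield X Y = X + - Y"

lift_definition scaleR_vfield :: "real \<Rightarrow> vfield \<Rightarrow> vfield" is "\<lambda>r D a. r *\<^sub>R D a"
proof -
  fix r :: real and D assume D: "is_vfield D"
  show "is_vfield (\<lambda>a. r *\<^sub>R D a)"
  proof (rule is_vfieldI)
    fix S a p assume "S \<in> stratum_closures" "a \<in> vanishing_ideal S" "p \<in> S"
    then show "cval (r *\<^sub>R D a) p = 0"
      using is_vfieldD(6)[OF D, of S a p] stratum_closure_subset[of S]
      by (auto simp: vanishing_ideal_def)
  qed (simp_all add: is_vfieldD(1-3)[OF D] algebra_simps)
qed

lemma vapp_simps [simp]:
  "vapp 0 a = 0" "vapp (X + Y) a = vapp X a + vapp Y a" "vapp (- X) a = - vapp X a"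
  "vapp (X - Y) a = vapp X a - vapp Y a" "vapp (r *\<^sub>R X) a = r *\<^sub>R vapp X a"
  by (simp_all add: zero_vfield.rep_eq plus_vfield.rep_eq uminus_vfield.rep_eq
      minus_vfield_def scaleR_vfield.rep_eq)

instance
  by standard (auto intro!: vfield_eqI simp: algebra_simps)

end

lift_definition vf_scale :: "cinf \<Rightarrow> vfield \<Rightarrow> vfield" (infixr \<open>*\<^sub>A\<close> 75) is "\<lambda>a D b. a * D b"
proof -
  fix c D assume D: "is_vfield D"
  show "is_vfield (\<lambda>a. c * D a)"
  proof (rule is_vfieldI)
    fix S a p assume "S \<in> stratum_closures" "a \<in> vanishing_ideal S" "p \<in> S"
    then show "cval (c * D a) p = 0"
      using is_vfieldD(6)[OF D, of S a p] stratum_closure_subset[of S]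
      by (auto simp: vanishing_ideal_def)
  qed (simp_all add: is_vfieldD(1-3)[OF D] algebra_simps)
qed

lemma module_vf_scale: "module vf_scale"
  by standard (auto intro!: vfield_eqI simp: vf_scale.rep_eq algebra_simps)

lift_definition bracket :: "vfield \<Rightarrow> vfield \<Rightarrow> vfield" is "\<lambda>D E a. D (E a) - E (D a)"
proof -
  fix D E assume DE: "is_vfield D" "is_vfield E"
  show "is_vfield (\<lambda>a. D (E a) - E (D a))"
  proof (rule is_vfieldI)
    fix S a p assume *: "S \<in> stratum_closures" "a \<in> vanishing_ideal S" "p \<in> S"
    then have a: "\<forall>p\<in>S. cval a p = 0"
      by (simp add: vanishing_ideal_def)
    have "\<forall>p\<in>S. cval (D a) p = 0" "\<forall>p\<in>S. cval (E a) p = 0"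
      using is_vfieldD(6)[OF DE(1) *(1) a] is_vfieldD(6)[OF DE(2) *(1) a] by blast+
    then show "cval (D (E a) - E (D a)) p = 0"
      using is_vfieldD(6)[OF DE(1) *(1) _ *(3)] is_vfieldD(6)[OF DE(2) *(1) _ *(3)]
        stratum_closure_subset[OF *(1)] *(3) by auto
  qed (simp_all add: is_vfieldD(1-3)[OF DE(1)] is_vfieldD(1-3)[OF DE(2)] algebra_simps)
qed

lemma cusp_tangent:
  assumes F: "smooth F" and 0: "\<And>p. discr p = 0 \<Longrightarrow> F p = 0"
  shows "- 6 * t * pd2 F (- 3 * t\<^sup>2, 2 * t ^ 3) + 6 * t\<^sup>2 * pd3 F (- 3 * t\<^sup>2, 2 * t ^ 3) = 0"
proof -
  let ?c = "\<lambda>t :: real. (- 3 * t\<^sup>2, 2 * t ^ 3)"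
  have "(?c has_derivative (\<lambda>h. (h * (- 6 * t), h * (6 * t\<^sup>2)))) (at t)"
    by (auto intro!: derivative_eq_intros simp: fun_eq_iff power2_eq_square)
  then have "((\<lambda>t. F (?c t)) has_derivative
      (\<lambda>h. frechet_derivative F (at (?c t)) (h * (- 6 * t), h * (6 * t\<^sup>2)))) (at t)"
    by (rule has_derivative_compose[OF _ smooth_has_derivative[OF F]])
  moreover have "(\<lambda>t. F (?c t)) = (\<lambda>t. 0)"
    by (rule ext, rule 0) (simp add: discr_def power_mult_distrib flip: power_mult)
  ultimately have "((\<lambda>t. 0 :: real) has_derivative
      (\<lambda>h. frechet_derivative F (at (?c t)) (h * (- 6 * t), h * (6 * t\<^sup>2)))) (at t)"
    by simp
  then have "(\<lambda>h. frechet_derivative F (at (?c t)) (h * (- 6 * t), h * (6 * t\<^sup>2))) = (\<lambda>h. 0)"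
    by (rule has_derivative_unique[OF _ has_derivative_const])
  from fun_cong[OF this, of 1] show ?thesis
    by (simp add: frechet_eq_pd[OF F])
qed

lemma cusp_param:
  assumes "discr p = 0"
  obtains t where "p = (- 3 * t\<^sup>2, 2 * t ^ 3)"
proof -
  define t where "t = root 3 (snd p / 2)"
  have t: "t ^ 3 = snd p / 2"
    unfolding t_def by (rule odd_real_root_pow) simp
  have "snd p ^ 2 = 4 * t ^ 6"
    using power_mult[of t 3 2] unfolding t by (simp add: power_divide)
  then have "fst p ^ 3 = (- 3 * t\<^sup>2) ^ 3"
    using assms by (simp add: discr_def case_prod_beta power_mult_distrib flip: power_mult)
  then have "fst p = - 3 * t\<^sup>2"
    by (rule cube_inj)
  then show ?thesis
    using that[of t] t by (metis nonzero_mult_div_cancel_left prod.collapse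
        times_divide_eq_right zero_neq_numeral)
qed

text \<open>A combination \<open>a \<partial>\<^sub>2 + b \<partial>\<^sub>3\<close> whose coefficients are tangent to the cusp \<open>\<Delta> = 0\<close>
  and vanish at the origin preserves the vanishing ideals.\<close>

lemma is_vfield_combination:
  assumes cusp: "\<And>t. \<exists>m. cval a (- 3 * t\<^sup>2, 2 * t ^ 3) = m * (- 6 * t)
      \<and> cval b (- 3 * t\<^sup>2, 2 * t ^ 3) = m * (6 * t\<^sup>2)"
    and origin: "cval a (0, 0) = 0" "cval b (0, 0) = 0"
  shows "is_vfield (\<lambda>c. a * dd2 c + b * dd3 c)"
proof -
  let ?D = "\<lambda>c. a * dd2 c + b * dd3 c"
  have val: "cval (?D (cinf_of F)) p = cval a p * pd2 F p + cval b p * pd3 F p"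
    if "smooth F" "p \<in> XX" for F p
    using that by (simp add: dd_cinf_of smooth_intros)
  show ?thesis
  proof (rule is_vfieldI)
    fix c d
    obtain F where F: "smooth F" "c = cinf_of F"
      using ex_cinf_of by metis
    obtain H where H: "smooth H" "d = cinf_of H"
      using ex_cinf_of by metis
    have "c + d = cinf_of (\<lambda>p. F p + H p)"
      by (rule cinf_eqI) (simp add: F H smooth_intros)
    then show "?D (c + d) = ?D c + ?D d"
      by (intro cinf_eqI)
        (simp add: dd_cinf_of F H smooth_intros pd_add algebra_simps)
    have "c * d = cinf_of (\<lambda>p. F p * H p)"
      by (rule cinf_eqI) (simp add: F H smooth_intros)
    then show "?D (c * d) = ?D c * d + c * ?D d"
      by (intro cinf_eqI) (simp add: dd_cinf_of F H smooth_intros pd_mult algebra_simps)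
  next
    fix r :: real and c
    obtain F where F: "smooth F" "c = cinf_of F"
      using ex_cinf_of by metis
    have "r *\<^sub>R c = cinf_of (\<lambda>p. r * F p)"
      by (rule cinf_eqI) (simp add: F smooth_intros)
    then show "?D (r *\<^sub>R c) = r *\<^sub>R ?D c"
      by (intro cinf_eqI)
        (simp add: dd_cinf_of F smooth_intros pd_mult pd_const algebra_simps)
  next
    fix S c p assume S: "S \<in> stratum_closures" and c: "c \<in> vanishing_ideal S" and p: "p \<in> S"
    obtain F where F: "smooth F" "c = cinf_of F"
      using ex_cinf_of by metis
    have SX: "S \<subseteq> XX"
      using S by (rule stratum_closure_subset)
    have F0: "F q = 0" if "q \<in> S" for q
      using c that SX F cval_cinf_of_at unfolding vanishing_ideal_def by fastforce
    have pX: "p \<in> XX"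
      using SX p by blast
    consider "S = XX" | "S = {p. discr p = 0}" | "S = {(0, 0)}"
      using S by (auto simp: stratum_closures_def)
    then have "cval a p * pd2 F p + cval b p * pd3 F p = 0"
    proof cases
      case 1
      then show ?thesis
        using frechet_zero_on_XX[OF F(1) F0] pX by (simp add: pd2_def pd3_def)
    next
      case 2
      then obtain t where t: "p = (- 3 * t\<^sup>2, 2 * t ^ 3)"
        using p cusp_param by blast
      obtain m where m: "cval a p = m * (- 6 * t)" "cval b p = m * (6 * t\<^sup>2)"
        using cusp[of t] t by blast
      have "- 6 * t * pd2 F p + 6 * t\<^sup>2 * pd3 F p = 0"
        using cusp_tangent[OF F(1), of t] F0 2 t by blast
      then have "m * (- 6 * t * pd2 F p + 6 * t\<^sup>2 * pd3 F p) = 0"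
        by simp
      then show ?thesis
        by (simp add: m algebra_simps)
    next
      case 3
      then show ?thesis using p origin by simp
    qed
    then show "cval (?D c) p = 0"
      using val[OF F(1) pX] F(2) by simp
  qed
qed

lemma cusp_in_XX: "(- 3 * t\<^sup>2, 2 * t ^ 3) \<in> XX"
  by (simp add: XX_def discr_def power_mult_distrib flip: power_mult)

lift_definition zeta1 :: vfield is "\<lambda>a. (2 * U2) * dd2 a + (3 * U3) * dd3 a"
proof (rule is_vfield_combination)
  fix t :: real
  show "\<exists>m. cval (2 * U2) (- 3 * t\<^sup>2, 2 * t ^ 3) = m * (- 6 * t)
      \<and> cval (3 * U3) (- 3 * t\<^sup>2, 2 * t ^ 3) = m * (6 * t\<^sup>2)"
    using cusp_in_XX[of t]
    by (intro exI[of _ t]) (simp add: U2_def U3_def smooth_intros power2_eq_square power3_eq_cube)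
qed (simp_all add: U2_def U3_def smooth_intros zero_in_XX)

lift_definition zeta2 :: vfield is "\<lambda>a. (- 9 * U3) * dd2 a + (2 * U2 ^ 2) * dd3 a"
proof (rule is_vfield_combination)
  fix t :: real
  show "\<exists>m. cval (- 9 * U3) (- 3 * t\<^sup>2, 2 * t ^ 3) = m * (- 6 * t)
      \<and> cval (2 * U2 ^ 2) (- 3 * t\<^sup>2, 2 * t ^ 3) = m * (6 * t\<^sup>2)"
    using cusp_in_XX[of t]
    by (intro exI[of _ "3 * t\<^sup>2"])
      (simp add: U2_def U3_def smooth_intros power2_eq_square power3_eq_cube)
qed (simp_all add: U2_def U3_def smooth_intros zero_in_XX)

definition zeta :: "2 \<Rightarrow> vfield" where
  "zeta i = (if i = 1 then zeta1 else zeta2)"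


section \<open>Metrics and connections\<close>

text \<open>\<open>inj G\<close> is the injectivity of the map sending \<open>X\<close> to the linear form \<open>G X\<close>.\<close>

definition semi_riemannian_metric :: "(vfield \<Rightarrow> vfield \<Rightarrow> cinf) \<Rightarrow> bool" where
  "semi_riemannian_metric G \<longleftrightarrow>
     (\<forall>X Y. G X Y = G Y X) \<and>
     (\<forall>X. module_hom vf_scale (*) (G X)) \<and>
     (\<forall>Y. module_hom vf_scale (*) (\<lambda>X. G X Y)) \<and>
     inj G"

definition connection :: "(vfield \<Rightarrow> vfield \<Rightarrow> vfield) \<Rightarrow> bool" where
  "connection N \<longleftrightarrow>
     (\<forall>Y. module_hom vf_scale vf_scale (\<lambda>X. N X Y)) \<and>
     (\<forall>X. linear (N X)) \<and>
     (\<forall>X a Y. N X (a *\<^sub>A Y) = vapp X a *\<^sub>A Y + a *\<^sub>A N X Y)"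

definition metric_connection ::
  "(vfield \<Rightarrow> vfield \<Rightarrow> cinf) \<Rightarrow> (vfield \<Rightarrow> vfield \<Rightarrow> vfield) \<Rightarrow> bool" where
  "metric_connection G N \<longleftrightarrow> (\<forall>X Y Z. vapp X (G Y Z) = G (N X Y) Z + G Y (N X Z))"

definition torsion_free :: "(vfield \<Rightarrow> vfield \<Rightarrow> vfield) \<Rightarrow> bool" where
  "torsion_free N \<longleftrightarrow> (\<forall>X Y. N X Y - N Y X = bracket X Y)"

definition levi_civita ::
  "(vfield \<Rightarrow> vfield \<Rightarrow> cinf) \<Rightarrow> (vfield \<Rightarrow> vfield \<Rightarrow> vfield) \<Rightarrow> bool" where
  "levi_civita G N \<longleftrightarrow> connection N \<and> metric_connection G N \<and> torsion_free N"

definition curvature ::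
  "(vfield \<Rightarrow> vfield \<Rightarrow> vfield) \<Rightarrow> vfield \<Rightarrow> vfield \<Rightarrow> vfield \<Rightarrow> vfield" where
  "curvature N X Y Z = N X (N Y Z) - N Y (N X Z) - N (bracket X Y) Z"

definition flat :: "(vfield \<Rightarrow> vfield \<Rightarrow> vfield) \<Rightarrow> bool" where
  "flat N \<longleftrightarrow> (\<forall>X Y Z. curvature N X Y Z = 0)"

text \<open>The upper index \<open>k\<close> of a Christoffel symbol is the row, the lower index \<open>j\<close> the column.\<close>

definition is_christoffel_matrix ::
  "(vfield \<Rightarrow> vfield \<Rightarrow> vfield) \<Rightarrow> 2 \<Rightarrow> cinf ^ 2 ^ 2 \<Rightarrow> bool" where
  "is_christoffel_matrix N i C \<longleftrightarrow>
     (\<forall>j. N (zeta i) (zeta j) = (\<Sum>k\<in>UNIV. (C $ k $ j) *\<^sub>A zeta k))"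

text \<open>The partial derivatives of \<open>log f\<close>, for nowhere vanishing \<open>f\<close> of either sign.\<close>

definition dlog2 :: "(plane \<Rightarrow> real) \<Rightarrow> plane \<Rightarrow> real" where
  "dlog2 f p = pd2 f p / f p"

definition dlog3 :: "(plane \<Rightarrow> real) \<Rightarrow> plane \<Rightarrow> real" where
  "dlog3 f p = pd3 f p / f p"

lemma Ck_inverse:
  assumes "\<And>p. F p \<noteq> 0"
  shows "Ck k F \<Longrightarrow> Ck k (\<lambda>p. inverse (F p))"
proof (induction k)
  case 0
  then show ?case using assms by (simp add: continuous_on_inverse)
next
  case (Suc k)
  have F: "F differentiable (at p)" "Ck k (\<lambda>p. frechet_derivative F (at p) v)" for p v
    using Suc.prems unfolding Ck.simps by blast+
  have d: "((\<lambda>p. inverse (F p)) has_derivative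
      (\<lambda>v. - (inverse (F p) * frechet_derivative F (at p) v * inverse (F p)))) (at p)" for p
    by (rule Deriv.has_derivative_inverse[OF assms F(1)[unfolded frechet_derivative_works]])
  have e: "frechet_derivative (\<lambda>p. inverse (F p)) (at p) v
      = (- 1 * inverse (F p)) * (frechet_derivative F (at p) v * inverse (F p))" for p v
    using fun_cong[OF frechet_derivative_at[OF d[of p]], of v] by simp
  have I: "Ck k (\<lambda>p. inverse (F p))"
    using Suc Ck_Suc_imp by blast
  have "Ck k (\<lambda>p. (- 1 * inverse (F p)) * (frechet_derivative F (at p) v * inverse (F p)))" for v
    by (intro Ck_mult Ck_const I F)
  moreover have "(\<lambda>p. inverse (F p)) differentiable (at p)" for p
    using d differentiable_def by blast
  ultimately show ?case
    unfolding Ck.simps e by blast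
qed

lemma smooth_dlog:
  assumes "smooth f" "\<And>p. f p \<noteq> 0"
  shows "smooth (dlog2 f)" "smooth (dlog3 f)"
proof -
  have "smooth (\<lambda>p. inverse (f p))"
    using assms Ck_inverse by (simp add: smooth_def)
  then show "smooth (dlog2 f)" "smooth (dlog3 f)"
    using smooth_mult smooth_pd[OF assms(1)]
    unfolding dlog2_def dlog3_def divide_inverse by blast+
qed

definition is_metric_of :: "(plane \<Rightarrow> real) \<Rightarrow> (vfield \<Rightarrow> vfield \<Rightarrow> cinf) \<Rightarrow> bool" where
  "is_metric_of f G \<longleftrightarrow> semi_riemannian_metric G \<and>
     G zeta1 zeta1 = - U2 * cinf_of f \<and>
     G zeta1 zeta2 = (9 / 2) *\<^sub>R (U3 * cinf_of f) \<and>
     G zeta2 zeta1 = (9 / 2) *\<^sub>R (U3 * cinf_of f) \<and>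
     G zeta2 zeta2 = 3 * U2 ^ 2 * cinf_of f"

end

theory Submission
  imports Defs
begin

text \<open>
  Everything rests on the fact that the vector fields on \<open>\<X>\<close> form a free module on \<open>\<zeta>\<^sub>1\<close> and
  \<open>\<zeta>\<^sub>2\<close> (\<open>ex_coordinates\<close>, \<open>coordinates_unique\<close>). Granted this, bilinear forms and connections can
  be prescribed arbitrarily on the generators, which gives the metric and its connection. The
  defects of compatibility with the metric, of torsion and of flatness are multilinear over
  \<open>\<C>\<^sup>\<infinity>(\<X>)\<close>, so they are examined on the generators only
  (\<open>metric_connection_if_basis\<close>, \<open>torsion_free_if_basis\<close>, \<open>flat_if_basis\<close>). There they, as well as
  the curvature formulas, are polynomial identities in \<open>u\<^sup>2\<close>, \<open>u\<^sup>3\<close>, \<open>f\<close> and the derivatives of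
  \<open>log f\<close>, once \<open>\<partial>\<^sub>2\<partial>\<^sub>3 log f = \<partial>\<^sub>3\<partial>\<^sub>2 log f\<close> is taken into account (\<open>dlog_closed\<close>). The form is
  nondegenerate because its Gram determinant is \<open>-3/4 f\<^sup>2 \<Delta>\<close> and \<open>\<Delta> \<noteq> 0\<close> on a dense subset of \<open>\<X>\<close>.

  For the freeness, Hadamard's lemma shows that a derivation \<open>X\<close> is \<open>a \<partial>\<^sub>2 + b \<partial>\<^sub>3\<close> with \<open>a = X u\<^sup>2\<close>
  and \<open>b = X u\<^sup>3\<close> (\<open>vapp_eq_partials\<close>). Cramer's rule then forces the coefficients of \<open>\<zeta>\<^sub>1\<close> and \<open>\<zeta>\<^sub>2\<close> to be
  \<open>(2 (u\<^sup>2)^2 a + 9 u\<^sup>3 b) / \<Delta>\<close> and \<open>(2 u\<^sup>2 b - 3 u\<^sup>3 a) / \<Delta>\<close>. Tangency of \<open>X\<close> to the strata says that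
  both numerators vanish on the cusp \<open>\<Delta> = 0\<close> (\<open>tangency\<close>). So the analytic core is
  \<open>division_by_discr\<close>: a smooth function on the plane that vanishes on the cusp is \<open>\<Delta>\<close> times a
  smooth function.

  To prove it, regard \<open>\<Delta>\<close> as a quadratic polynomial in \<open>u\<^sup>3\<close> and divide with remainder
  \<open>r\<^sub>0(u\<^sup>2) + u\<^sup>3 r\<^sub>1(u\<^sup>2)\<close>, where quotient and remainder are only of class \<open>C^k\<close>
  (\<open>divides_with_remainder_smooth\<close>). For \<open>u\<^sup>2 < 0\<close> the polynomial has two distinct real roots, which lie
  on the cusp, so there the remainder is zero. It is therefore flat along \<open>u\<^sup>2 = 0\<close>; as
  \<open>\<Delta> \<ge> 4 (u\<^sup>2)^3\<close>, its quotient by \<open>\<Delta>\<close> extends by zero from \<open>u\<^sup>2 > 0\<close> to a function that is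
  still differentiable many times (\<open>flat_factor\<close>, \<open>Ck_right_quotient\<close>). This gives a quotient of
  class \<open>C^k\<close> for each \<open>k\<close>; by density of \<open>\<Delta> \<noteq> 0\<close> all of these coincide, hence the quotient is
  smooth. Working with one finite \<open>k\<close> at a time, extensions by zero take the place of Whitney's theorem
  on smooth even functions.
\<close>


section \<open>Finite differentiability and integrals over segments\<close>

lemma Ck_SucI:
  assumes "\<And>p. (F has_derivative (\<lambda>h. fst h * A p + snd h * B p)) (at p)"
    and "Ck k A" "Ck k B"
  shows "Ck (Suc k) F"
proof -
  have "frechet_derivative F (at p) v = fst v * A p + snd v * B p" for p v
    using fun_cong[OF frechet_derivative_at[OF assms(1)[of p]], of v] by simp
  moreover have "Ck k (\<lambda>p. fst v * A p + snd v * B p)" for v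
    by (intro Ck_add Ck_mult Ck_const assms)
  moreover have "F differentiable (at p)" for p
    using assms(1) differentiable_def by blast
  ultimately show ?thesis
    unfolding Ck.simps by presburger
qed

lemma Ck_Suc_pd:
  assumes "Ck (Suc k) F"
  shows "Ck k (pd2 F)" "Ck k (pd3 F)"
    and "(F has_derivative (\<lambda>h. fst h * pd2 F p + snd h * pd3 F p)) (at p)"
proof -
  show "Ck k (pd2 F)" "Ck k (pd3 F)"
    using assms by (simp_all add: pd2_def[abs_def] pd3_def[abs_def])
  have D: "(F has_derivative frechet_derivative F (at p)) (at p)"
    using assms frechet_derivative_works unfolding Ck.simps by blast
  have "frechet_derivative F (at p) h = fst h * pd2 F p + snd h * pd3 F p" for h
  proof -
    have l: "linear (frechet_derivative F (at p))"
      using D has_derivative_linear by blast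
    have "h = fst h *\<^sub>R (1, 0) + snd h *\<^sub>R (0, 1 :: real)"
      by (cases h) simp
    then show ?thesis
      unfolding pd2_def pd3_def using linear_add[OF l] linear_scale[OF l]
      by (metis real_scaleR_def)
  qed
  then show "(F has_derivative (\<lambda>h. fst h * pd2 F p + snd h * pd3 F p)) (at p)"
    using D by presburger
qed

lemma Ck_mono: "Ck n F \<Longrightarrow> k \<le> n \<Longrightarrow> Ck k F"
  by (induction n) (auto simp: le_Suc_eq simp del: Ck.simps dest: Ck_Suc_imp)

lemma Ck_continuous_on: "Ck k F \<Longrightarrow> continuous_on S F"
  using Ck_mono[of k F 0] continuous_on_subset[OF _ subset_UNIV] by auto

lemma Ck_power: "Ck k F \<Longrightarrow> Ck k (\<lambda>p. F p ^ n)"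
  by (induction n) (simp_all add: Ck_const Ck_mult)

lemma smooth_Ck: "smooth F \<Longrightarrow> Ck k F"
  by (simp add: smooth_def)

text \<open>The power of \<open>t\<close> is there because differentiation in \<open>p\<close> produces factors \<open>t\<close> from the chain rule:
  with all moments at hand the derivatives of such integrals are again such integrals.\<close>

definition segment_moment ::
  "nat \<Rightarrow> (plane \<Rightarrow> plane) \<Rightarrow> (plane \<Rightarrow> plane) \<Rightarrow> (plane \<Rightarrow> real) \<Rightarrow> plane \<Rightarrow> real" where
  "segment_moment i A B g p = integral {0..1} (\<lambda>t. t ^ i * g (A p + t *\<^sub>R B p))"

definition smooth_map :: "(plane \<Rightarrow> plane) \<Rightarrow> bool" where
  "smooth_map A \<longleftrightarrow> smooth (\<lambda>p. fst (A p)) \<and> smooth (\<lambda>p. snd (A p))"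

lemma smooth_map_continuous_on: "smooth_map A \<Longrightarrow> continuous_on S A"
proof -
  assume "smooth_map A"
  then have "continuous_on S (\<lambda>p. (fst (A p), snd (A p)))"
    unfolding smooth_map_def by (intro continuous_on_Pair smooth_continuous_on) auto
  then show ?thesis by simp
qed

lemma continuous_on_moment_integrand:
  assumes "smooth_map A" "smooth_map B" "Ck k g"
  shows "continuous_on S (\<lambda>z. snd z ^ i * g (A (fst z) + snd z *\<^sub>R B (fst z)))"
proof -
  have "continuous_on S (\<lambda>z. A (fst z) + snd z *\<^sub>R B (fst z))"
    by (intro continuous_intros
        continuous_on_compose2[OF smooth_map_continuous_on[OF assms(1), of UNIV]]
        continuous_on_compose2[OF smooth_map_continuous_on[OF assms(2), of UNIV]]) auto
  then have "continuous_on S (\<lambda>z. g (A (fst z) + snd z *\<^sub>R B (fst z)))"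
    by (rule continuous_on_compose2[OF Ck_continuous_on[OF assms(3), of UNIV]]) simp
  then show ?thesis
    by (intro continuous_on_mult continuous_on_power continuous_on_snd continuous_on_id)
qed

lemma moment_integrable:
  assumes "smooth_map A" "smooth_map B" "Ck k g"
  shows "(\<lambda>t. t ^ i * g (A p + t *\<^sub>R B p)) integrable_on {0..1}"
proof (rule integrable_continuous_real)
  have "continuous_on {0..1} ((\<lambda>z. snd z ^ i * g (A (fst z) + snd z *\<^sub>R B (fst z))) \<circ> Pair p)"
    by (intro continuous_on_compose continuous_intros continuous_on_moment_integrand[OF assms])
  then show "continuous_on {0..1} (\<lambda>t. t ^ i * g (A p + t *\<^sub>R B p))"
    by (simp add: o_def)
qed

text \<open>By Leibniz' rule the partial derivatives are combinations, with smooth coefficients, of moments of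
  the partial derivatives of \<open>g\<close>; these have one derivative less, so the claim follows by induction.\<close>

lemma Ck_segment_moment:
  assumes A: "smooth_map A" and B: "smooth_map B"
  shows "Ck k g \<Longrightarrow> Ck k (segment_moment i A B g)"
proof (induction k arbitrary: g i)
  case 0
  have "continuous_on UNIV (\<lambda>p. integral (cbox 0 1) (\<lambda>t. t ^ i * g (A p + t *\<^sub>R B p)))"
    by (rule integral_continuous_on_param)
      (use continuous_on_moment_integrand[OF A B 0] in \<open>simp add: case_prod_beta\<close>)
  then show ?case
    by (simp add: segment_moment_def[abs_def])
next
  case (Suc k)
  note g = Ck_Suc_pd[OF Suc.prems]
  let ?q = "\<lambda>p t. A p + t *\<^sub>R B p"
  define A1 A2 B1 B2 where "A1 p = fst (A p)" and "A2 p = snd (A p)"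
    and "B1 p = fst (B p)" and "B2 p = snd (B p)" for p
  have AB: "smooth A1" "smooth A2" "smooth B1" "smooth B2"
    using A B by (simp_all add: smooth_map_def A1_def[abs_def] A2_def[abs_def]
        B1_def[abs_def] B2_def[abs_def])
  define J where "J d p t =
    t ^ i * pd2 g (?q p t) * d A1 p + t ^ Suc i * pd2 g (?q p t) * d B1 p
    + (t ^ i * pd3 g (?q p t) * d A2 p + t ^ Suc i * pd3 g (?q p t) * d B2 p)" 
    for d :: "(plane \<Rightarrow> real) \<Rightarrow> plane \<Rightarrow> real" and p t
  define I where "I d p =
    segment_moment i A B (pd2 g) p * d A1 p + segment_moment (Suc i) A B (pd2 g) p * d B1 p
    + (segment_moment i A B (pd3 g) p * d A2 p + segment_moment (Suc i) A B (pd3 g) p * d B2 p)"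
    for d :: "(plane \<Rightarrow> real) \<Rightarrow> plane \<Rightarrow> real" and p
  have J_int: "(J d p has_integral I d p) {0..1}" for d p
    unfolding J_def[abs_def] I_def segment_moment_def
    by (intro has_integral_add has_integral_mult_left integrable_integral
        moment_integrable[OF A B g(1)] moment_integrable[OF A B g(2)])
  have J_cont: "continuous_on UNIV (\<lambda>z. J d (fst z) (snd z))"
    if "\<And>F. smooth F \<Longrightarrow> smooth (d F)" for d
    unfolding J_def
    by (intro continuous_on_add continuous_on_mult continuous_on_moment_integrand[OF A B g(1)]
        continuous_on_moment_integrand[OF A B g(2)] continuous_on_compose2[OF smooth_continuous_on]
        that AB continuous_on_fst continuous_on_id) auto
  have J_der: "((\<lambda>p. t ^ i * g (?q p t)) has_derivative (\<lambda>h. fst h * J pd2 p t + snd h * J pd3 p t)) (at p)"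
    for p t
  proof -
    have q: "?q p t = (A1 p + t * B1 p, A2 p + t * B2 p)" for p
      by (simp add: A1_def A2_def B1_def B2_def prod_eq_iff)
    have "((\<lambda>p. (A1 p + t * B1 p, A2 p + t * B2 p)) has_derivative
       (\<lambda>h. (fst h * pd2 A1 p + snd h * pd3 A1 p + t * (fst h * pd2 B1 p + snd h * pd3 B1 p),
             fst h * pd2 A2 p + snd h * pd3 A2 p + t * (fst h * pd2 B2 p + snd h * pd3 B2 p)))) (at p)"
      by (intro has_derivative_Pair has_derivative_add has_derivative_mult_right
          Ck_Suc_pd(3)[OF smooth_Ck[of _ "Suc 0"]] AB)
    from has_derivative_compose[OF this g(3)]
    have "((\<lambda>p. t ^ i * g (A1 p + t * B1 p, A2 p + t * B2 p)) has_derivative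
       (\<lambda>h. t ^ i * ((fst h * pd2 A1 p + snd h * pd3 A1 p + t * (fst h * pd2 B1 p + snd h * pd3 B1 p))
               * pd2 g (A1 p + t * B1 p, A2 p + t * B2 p)
            + (fst h * pd2 A2 p + snd h * pd3 A2 p + t * (fst h * pd2 B2 p + snd h * pd3 B2 p))
               * pd3 g (A1 p + t * B1 p, A2 p + t * B2 p)))) (at p)"
      by (intro has_derivative_mult_right) simp
    then show ?thesis
      unfolding J_def q by (rule back_subst[where P="\<lambda>D. (_ has_derivative D) (at p)"])
        (auto simp: fun_eq_iff algebra_simps)
  qed
  define fx :: "plane \<Rightarrow> real \<Rightarrow> plane \<Rightarrow>\<^sub>L real"
    where "fx p t = J pd2 p t *\<^sub>R fst_blinfun + J pd3 p t *\<^sub>R snd_blinfun" for p t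
  have fx_app: "blinfun_apply (fx p t) = (\<lambda>h. fst h * J pd2 p t + snd h * J pd3 p t)" for p t
    by (auto simp: fx_def blinfun.add_left blinfun.scaleR_left fun_eq_iff)
  have "((\<lambda>p. integral (cbox 0 1) (\<lambda>t. t ^ i * g (?q p t))) has_derivative
      integral (cbox 0 1) (fx p)) (at p within UNIV)" for p
  proof (rule leibniz_rule)
    show "((\<lambda>p. t ^ i * g (?q p t)) has_derivative blinfun_apply (fx p t)) (at p within UNIV)" for p t
      using J_der by (simp add: fx_app)
    show "(\<lambda>t. t ^ i * g (?q p t)) integrable_on cbox 0 1" for p
      using moment_integrable[OF A B Suc.prems] by simp
    have "continuous_on UNIV (\<lambda>z. fx (fst z) (snd z))"
      unfolding fx_def by (intro continuous_intros J_cont smooth_pd)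
    then show "continuous_on (UNIV \<times> cbox 0 1) (\<lambda>(x, t). fx x t)"
      by (auto simp: case_prod_beta intro: continuous_on_subset)
  qed auto
  moreover have "integral (cbox 0 1) (fx p) = I pd2 p *\<^sub>R fst_blinfun + I pd3 p *\<^sub>R snd_blinfun" for p
    unfolding fx_def[abs_def] cbox_interval
    by (intro integral_unique has_integral_add has_integral_scaleR_left J_int)
  moreover have "blinfun_apply (I pd2 p *\<^sub>R fst_blinfun + I pd3 p *\<^sub>R snd_blinfun)
      = (\<lambda>h. fst h * I pd2 p + snd h * I pd3 p)" for p
    by (auto simp: blinfun.add_left blinfun.scaleR_left fun_eq_iff)
  ultimately have "(segment_moment i A B g has_derivative
      (\<lambda>h. fst h * I pd2 p + snd h * I pd3 p)) (at p)" for p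
    by (simp add: segment_moment_def[abs_def])
  moreover have "Ck k (I pd2)" "Ck k (I pd3)"
    unfolding I_def[abs_def]
    by (intro Ck_add Ck_mult Suc.IH g smooth_Ck smooth_pd AB)+
  ultimately show ?case
    by (rule Ck_SucI)
qed

text \<open>Hadamard's lemma: the fundamental theorem of calculus along the segment from \<open>A p\<close> to \<open>A p + B p\<close>.
  Letting the segment depend on \<open>p\<close> covers the expansion about a point, the expansion
  in one variable, and the comparison of two values of the second coordinate.\<close>

lemma hadamard:
  assumes F: "Ck (Suc k) F" and A: "smooth_map A" and B: "smooth_map B"
  shows "F (A p + B p) = F (A p) + fst (B p) * segment_moment 0 A B (pd2 F) p
      + snd (B p) * segment_moment 0 A B (pd3 F) p"
proof -
  let ?q = "\<lambda>t. A p + t *\<^sub>R B p"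
  note D = Ck_Suc_pd[OF F]
  have "((\<lambda>t. fst (B p) * (t ^ 0 * pd2 F (?q t)) + snd (B p) * (t ^ 0 * pd3 F (?q t)))
      has_integral F (?q 1) - F (?q 0)) {0..1}"
  proof (rule fundamental_theorem_of_calculus)
    fix t :: real
    have "(?q has_derivative (\<lambda>h. h *\<^sub>R B p)) (at t within {0..1})"
      by (auto intro!: derivative_eq_intros)
    from has_derivative_compose[OF this D(3)]
    show "((\<lambda>t. F (?q t)) has_vector_derivative
        fst (B p) * (t ^ 0 * pd2 F (?q t)) + snd (B p) * (t ^ 0 * pd3 F (?q t))) (at t within {0..1})"
      unfolding has_vector_derivative_def
      by (rule back_subst[where P="\<lambda>D. (_ has_derivative D) _"])
        (auto simp: fun_eq_iff algebra_simps)
  qed simp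
  moreover have "((\<lambda>t. fst (B p) * (t ^ 0 * pd2 F (?q t)) + snd (B p) * (t ^ 0 * pd3 F (?q t)))
      has_integral fst (B p) * segment_moment 0 A B (pd2 F) p
      + snd (B p) * segment_moment 0 A B (pd3 F) p) {0..1}"
    unfolding segment_moment_def
    by (intro has_integral_add has_integral_mult_right integrable_integral
        moment_integrable[OF A B D(1)] moment_integrable[OF A B D(2)])
  ultimately have "F (?q 1) - F (?q 0) = fst (B p) * segment_moment 0 A B (pd2 F) p
      + snd (B p) * segment_moment 0 A B (pd3 F) p"
    by (rule has_integral_unique)
  then show ?thesis by simp
qed

text \<open>Composition is the case of segments that are reduced to a point.\<close>

lemma Ck_compose:
  assumes "Ck k g" "smooth_map A"
  shows "Ck k (\<lambda>p. g (A p))"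
proof -
  have "smooth_map (\<lambda>p. 0)"
    by (simp add: smooth_map_def smooth_const)
  moreover have "segment_moment 0 A (\<lambda>p. 0) g = (\<lambda>p. g (A p))"
    by (simp add: segment_moment_def fun_eq_iff)
  ultimately show ?thesis
    using Ck_segment_moment[OF assms(2) _ assms(1), of "\<lambda>p. 0" 0] by simp
qed


section \<open>Functions extended by zero across a line\<close>

text \<open>As both factors vanish at \<open>p\<close>, continuity of the second one is enough. This is what allows
  differentiation, at the gluing line, of functions defined by zero on one side of it.\<close>

lemma has_derivative_mult_at_zero:
  fixes F G :: "plane \<Rightarrow> real"
  assumes F: "(F has_derivative F') (at p)" and "F p = 0" and G: "isCont G p" and "G p = 0"
  shows "((\<lambda>q. F q * G q) has_derivative (\<lambda>h. 0)) (at p)"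
proof -
  have lin: "bounded_linear F'"
    using F has_derivative_bounded_linear by blast
  define L where "L q = norm (F q - F p - F' (q - p)) / norm (q - p)" for q
  have L: "L \<midarrow>p\<rightarrow> 0"
    using F unfolding has_derivative_iff_norm L_def[abs_def] by blast
  have G0: "G \<midarrow>p\<rightarrow> 0"
    using G \<open>G p = 0\<close> isCont_def by metis
  have "(\<lambda>q. norm (F q * G q - F p * G p - 0) / norm (q - p)) \<midarrow>p\<rightarrow> 0"
  proof (rule Lim_null_comparison)
    have bound: "norm (norm (F q * G q - F p * G p - 0) / norm (q - p)) \<le> (L q + onorm F') * \<bar>G q\<bar>" for q
    proof (cases "q = p")
      case False
      have "\<bar>F q\<bar> \<le> norm (F q - F p - F' (q - p)) + norm (F' (q - p))"
        using \<open>F p = 0\<close> by simp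
      also have "\<dots> \<le> (L q + onorm F') * norm (q - p)"
        using False onorm[OF lin, of "q - p"] by (simp add: L_def distrib_right)
      finally have "\<bar>F q\<bar> / norm (q - p) \<le> L q + onorm F'"
        using False by (simp add: pos_divide_le_eq)
      from mult_right_mono[OF this, of "\<bar>G q\<bar>"] show ?thesis
        using assms(2) by (simp add: abs_mult)
    qed (use onorm_pos_le[OF lin] in \<open>simp add: L_def\<close>)
    show "\<forall>\<^sub>F q in at p. norm (norm (F q * G q - F p * G p - 0) / norm (q - p)) \<le> (L q + onorm F') * \<bar>G q\<bar>"
      using bound by (rule always_eventually[OF allI])
    have "(\<lambda>q. (L q + onorm F') * \<bar>G q\<bar>) \<midarrow>p\<rightarrow> (0 + onorm F') * \<bar>0\<bar>"
      by (intro tendsto_intros L G0)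
    then show "(\<lambda>q. (L q + onorm F') * \<bar>G q\<bar>) \<midarrow>p\<rightarrow> 0" by simp
  qed
  then show ?thesis
    unfolding has_derivative_iff_norm by simp
qed

text \<open>These functions undo the substitution of \<open>v\<^sup>2\<close> for the second coordinate: for even \<open>n\<close> and \<open>S\<close> even in
  \<open>v\<close>, or both odd, the value at \<open>(u, v\<^sup>2)\<close> is \<open>v ^ n * S (u, v)\<close>. The factor \<open>sqrt s ^ n\<close> makes the
  extension by zero to \<open>s \<le> 0\<close> differentiable about \<open>n / 2\<close> times.\<close>

definition half_power :: "nat \<Rightarrow> (plane \<Rightarrow> real) \<Rightarrow> plane \<Rightarrow> real" where
  "half_power n S p = (if 0 < snd p then sqrt (snd p) ^ n * S (fst p, sqrt (snd p)) else 0)"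

lemma continuous_half_power:
  assumes "Ck k S" "0 < n"
  shows "continuous_on UNIV (half_power n S)"
proof -
  have "half_power n S = (\<lambda>p. sqrt (max 0 (snd p)) ^ n * S (fst p, sqrt (max 0 (snd p))))"
    using \<open>0 < n\<close> by (auto simp: half_power_def fun_eq_iff max_def)
  moreover have "continuous_on UNIV (\<lambda>p :: plane. S (fst p, sqrt (max 0 (snd p))))"
    by (rule continuous_on_compose2[OF Ck_continuous_on[OF assms(1), of UNIV]])
      (auto intro!: continuous_intros)
  ultimately show ?thesis
    by (auto intro!: continuous_on_mult continuous_on_power continuous_intros)
qed

text \<open>Differentiation with respect to the second coordinate costs two factors \<open>sqrt s\<close> and leads to
  functions of the same kind.\<close>

lemma has_derivative_half_power:
  assumes S: "Ck (Suc k) S" and n: "2 < n"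
  shows "(half_power n S has_derivative
     (\<lambda>h. fst h * half_power n (pd2 S) p
        + snd h * ((real n / 2) * half_power (n - 2) S p + (1 / 2) * half_power (n - 1) (pd3 S) p))) (at p)"
proof -
  obtain m where m: "n = m + 2" "0 < m"
    using n by (metis add.commute less_imp_add_positive)
  consider "0 < snd p" | "snd p = 0" | "snd p < 0" by linarith
  then show ?thesis
  proof cases
    case 1
    have sq: "sqrt (snd p) \<noteq> 0" using 1 by simp
    have d_sqrt: "((\<lambda>q. sqrt (snd q)) has_derivative (\<lambda>h. snd h * (inverse (sqrt (snd p)) / 2))) (at p)"
      using 1 by (auto intro!: derivative_eq_intros)
    have d_S: "((\<lambda>q. S (fst q, sqrt (snd q))) has_derivative
       (\<lambda>h. fst h * pd2 S (fst p, sqrt (snd p))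
          + snd h * (inverse (sqrt (snd p)) / 2) * pd3 S (fst p, sqrt (snd p)))) (at p)"
      using has_derivative_compose[OF has_derivative_Pair[OF has_derivative_fst[OF has_derivative_ident] d_sqrt]
          Ck_Suc_pd(3)[OF S]] by simp
    have "((\<lambda>q. sqrt (snd q) ^ n * S (fst q, sqrt (snd q))) has_derivative
       (\<lambda>h. sqrt (snd p) ^ n * (fst h * pd2 S (fst p, sqrt (snd p))
          + snd h * (inverse (sqrt (snd p)) / 2) * pd3 S (fst p, sqrt (snd p)))
          + (real n * (snd h * (inverse (sqrt (snd p)) / 2)) * sqrt (snd p) ^ (n - 1))
             * S (fst p, sqrt (snd p)))) (at p)"
      using has_derivative_mult[OF has_derivative_power[OF d_sqrt, of n] d_S] by simp
    then have "((\<lambda>q. sqrt (snd q) ^ n * S (fst q, sqrt (snd q))) has_derivative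
     (\<lambda>h. fst h * half_power n (pd2 S) p
        + snd h * ((real n / 2) * half_power (n - 2) S p + (1 / 2) * half_power (n - 1) (pd3 S) p))) (at p)"
      by (rule back_subst[where P="\<lambda>D. (_ has_derivative D) _"])
        (use 1 sq in \<open>auto simp: half_power_def fun_eq_iff m field_simps\<close>)
    then show ?thesis
      by (rule has_derivative_transform_within_open[where s="{q. 0 < snd q}"])
        (use 1 in \<open>auto simp: half_power_def intro!: open_Collect_less continuous_intros\<close>)
  next
    case 2
    \<comment> \<open>on the gluing line, split off one factor \<open>s\<close> and keep a continuous rest\<close>
    have cont: "isCont (half_power m S) p"
      using continuous_half_power[OF S m(2)] continuous_on_eq_continuous_at[OF open_UNIV] by blast
    have "((\<lambda>q. snd q * half_power m S q) has_derivative (\<lambda>h. 0)) (at p)"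
      by (rule has_derivative_mult_at_zero[OF has_derivative_snd[OF has_derivative_ident]])
       (use 2 cont in \<open>auto simp: half_power_def[of _ _ p]\<close>)
    moreover have "half_power n S = (\<lambda>q. snd q * half_power m S q)"
      by (auto simp: half_power_def fun_eq_iff m(1) power_add)
    ultimately show ?thesis
      using 2 by (simp add: half_power_def[of _ _ p])
  next
    case 3
    have "((\<lambda>q. 0) has_derivative (\<lambda>h. 0)) (at p)" by simp
    then have "(half_power n S has_derivative (\<lambda>h. 0)) (at p)"
      by (rule has_derivative_transform_within_open[where s="{q. snd q < 0}"])
        (use 3 in \<open>auto simp: half_power_def intro!: open_Collect_less continuous_intros\<close>)
    then show ?thesis
      using 3 by (simp add: half_power_def[of _ _ p])
  qed
qed

lemma Ck_half_power: "Ck k S \<Longrightarrow> 2 * k < n \<Longrightarrow> Ck k (half_power n S)"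
proof (induction k arbitrary: n S)
  case 0
  show ?case using continuous_half_power[OF 0(1)] 0(2) by simp
next
  case (Suc k)
  note S = Ck_Suc_pd[OF Suc.prems(1)] and S' = Ck_Suc_imp[OF Suc.prems(1)]
  show ?case
  proof (rule Ck_SucI)
    show "(half_power n S has_derivative
       (\<lambda>h. fst h * half_power n (pd2 S) p
        + snd h * ((real n / 2) * half_power (n - 2) S p + (1 / 2) * half_power (n - 1) (pd3 S) p))) (at p)" for p
      by (rule has_derivative_half_power[OF Suc.prems(1)]) (use Suc.prems in simp)
    show "Ck k (half_power n (pd2 S))"
      "Ck k (\<lambda>p. (real n / 2) * half_power (n - 2) S p + (1 / 2) * half_power (n - 1) (pd3 S) p)"
      using Suc.prems(2) by (intro Ck_add Ck_mult Ck_const Suc.IH S S'; simp)+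
  qed
qed

text \<open>The class of functions \<open>u ^ a / \<Delta> ^ n\<close>, extended by zero to \<open>u \<le> 0\<close>, is closed under
  differentiation up to smooth factors. As \<open>\<Delta>\<close> is at least \<open>4 u ^ 3\<close>, the effective order of vanishing at
  \<open>u = 0\<close> is \<open>a - 3 n\<close>; a derivative lowers it by one or by three.\<close>

definition right_quotient :: "nat \<Rightarrow> nat \<Rightarrow> plane \<Rightarrow> real" where
  "right_quotient a n p = (if 0 < fst p then fst p ^ a / discr p ^ n else 0)"

lemma discr_pair: "discr p = 4 * fst p ^ 3 + 27 * snd p ^ 2"
  by (simp add: discr_def case_prod_beta)

lemma discr_ge: "4 * fst p ^ 3 \<le> discr p"
  by (simp add: discr_pair)

lemma discr_pos: "0 < fst p \<Longrightarrow> 0 < discr p"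
  using discr_ge[of p] zero_less_power[of "fst p" 3] by linarith

lemma has_derivative_discr:
  "(discr has_derivative (\<lambda>h. fst h * (12 * fst p ^ 2) + snd h * (54 * snd p))) (at p)"
  unfolding discr_pair[abs_def] by (auto intro!: derivative_eq_intros)

lemma right_quotient_bound:
  assumes "3 * n \<le> a"
  shows "\<bar>right_quotient a n p\<bar> \<le> \<bar>fst p\<bar> ^ (a - 3 * n)"
proof (cases "0 < fst p")
  case True
  have "fst p ^ a = fst p ^ (a - 3 * n) * (fst p ^ 3) ^ n"
    using assms by (simp flip: power_mult power_add)
  also have "\<dots> \<le> fst p ^ (a - 3 * n) * discr p ^ n"
    using True discr_ge[of p] zero_less_power[of "fst p" 3]
    by (intro mult_left_mono power_mono zero_le_power) linarith+
  finally show ?thesis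
    using True discr_pos[OF True] by (simp add: right_quotient_def divide_le_eq abs_mult)
qed (simp add: right_quotient_def)

lemma has_derivative_right_quotient_pos:
  assumes "0 < fst p" "0 < a"
  shows "(right_quotient a n has_derivative
     (\<lambda>h. fst h * (real a * right_quotient (a - 1) n p - 12 * real n * right_quotient (a + 2) (Suc n) p)
        + snd h * (- 54 * real n * snd p * right_quotient a (Suc n) p))) (at p)"
proof -
  note D = discr_pos[OF assms(1)]
  have "((\<lambda>q. fst q ^ a * inverse (discr q) ^ n) has_derivative
     (\<lambda>h. fst p ^ a * (real n * (- (inverse (discr p) * (fst h * (12 * fst p ^ 2) + snd h * (54 * snd p)) * inverse (discr p)))
            * inverse (discr p) ^ (n - 1))
        + (real a * fst h * fst p ^ (a - 1)) * inverse (discr p) ^ n)) (at p)"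
    by (intro has_derivative_mult has_derivative_power has_derivative_discr
         has_derivative_fst has_derivative_ident Deriv.has_derivative_inverse) (use D in auto)
  then have "((\<lambda>q. fst q ^ a * inverse (discr q) ^ n) has_derivative
     (\<lambda>h. fst h * (real a * right_quotient (a - 1) n p - 12 * real n * right_quotient (a + 2) (Suc n) p)
        + snd h * (- 54 * real n * snd p * right_quotient a (Suc n) p))) (at p)"
  proof (rule back_subst[where P="\<lambda>D. (_ has_derivative D) _"])
    show "(\<lambda>h. fst p ^ a * (real n * (- (inverse (discr p) * (fst h * (12 * fst p ^ 2) + snd h * (54 * snd p)) * inverse (discr p)))
            * inverse (discr p) ^ (n - 1))
        + (real a * fst h * fst p ^ (a - 1)) * inverse (discr p) ^ n) =
      (\<lambda>h. fst h * (real a * right_quotient (a - 1) n p - 12 * real n * right_quotient (a + 2) (Suc n) p)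
        + snd h * (- 54 * real n * snd p * right_quotient a (Suc n) p))"
      using assms D
      by (cases n) (auto simp: right_quotient_def fun_eq_iff field_simps power2_eq_square)
  qed
  then show ?thesis
    by (rule has_derivative_transform_within_open[where s="{q. 0 < fst q}"])
      (use assms in \<open>auto simp: right_quotient_def divide_inverse power_inverse
         intro!: open_Collect_less continuous_intros\<close>)
qed

lemma continuous_right_quotient:
  assumes "3 * n < a"
  shows "isCont (right_quotient a n) p"
proof (cases "0 < fst p")
  case True
  then show ?thesis
    using has_derivative_continuous[OF has_derivative_right_quotient_pos[OF True]] assms by simp
next
  case False
  consider "fst p < 0" | "fst p = 0" using False by linarith
  then show ?thesis
  proof cases
    case 1
    then have "\<forall>\<^sub>F q in nhds p. right_quotient a n q = 0"
      by (intro eventually_nhds[THEN iffD2] exI[of _ "{q. fst q < 0}"])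
        (auto simp: right_quotient_def intro!: open_Collect_less continuous_intros)
    then show ?thesis
      using isCont_cong[of "right_quotient a n" "\<lambda>q. 0" p] by simp
  next
    case 2
    have "(right_quotient a n) \<midarrow>p\<rightarrow> 0"
    proof (rule Lim_null_comparison)
      show "\<forall>\<^sub>F q in at p. norm (right_quotient a n q) \<le> \<bar>fst q\<bar> ^ (a - 3 * n)"
        using right_quotient_bound[of n a] assms by (simp add: always_eventually)
      have "(\<lambda>q. \<bar>fst q\<bar> ^ (a - 3 * n)) \<midarrow>p\<rightarrow> \<bar>fst p\<bar> ^ (a - 3 * n)"
        by (intro tendsto_intros)
      then show "(\<lambda>q. \<bar>fst q\<bar> ^ (a - 3 * n)) \<midarrow>p\<rightarrow> 0"
        using 2 assms by (simp only: abs_zero zero_power[OF zero_less_diff[THEN iffD2]])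
    qed
    then show ?thesis
      using 2 by (simp add: isCont_def right_quotient_def)
  qed
qed

lemma has_derivative_right_quotient:
  assumes "3 * n + 1 < a"
  shows "(right_quotient a n has_derivative
     (\<lambda>h. fst h * (real a * right_quotient (a - 1) n p - 12 * real n * right_quotient (a + 2) (Suc n) p)
        + snd h * (- 54 * real n * snd p * right_quotient a (Suc n) p))) (at p)"
proof -
  consider "0 < fst p" | "fst p = 0" | "fst p < 0" by linarith
  then show ?thesis
  proof cases
    case 1
    then show ?thesis using has_derivative_right_quotient_pos assms by simp
  next
    case 2
    obtain b where b: "a = Suc b" "3 * n < b"
      using assms by (cases a) auto
    have "((\<lambda>q. fst q * right_quotient b n q) has_derivative (\<lambda>h. 0)) (at p)"
      by (rule has_derivative_mult_at_zero[OF has_derivative_fst[OF has_derivative_ident]])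
       (use 2 continuous_right_quotient[OF b(2)] in \<open>auto simp: right_quotient_def[of _ _ p]\<close>)
    moreover have "right_quotient a n = (\<lambda>q. fst q * right_quotient b n q)"
      by (simp add: right_quotient_def fun_eq_iff b)
    ultimately show ?thesis
      using 2 by (simp add: right_quotient_def[of _ _ p])
  next
    case 3
    have "((\<lambda>q. 0) has_derivative (\<lambda>h. 0)) (at p)" by simp
    then have "(right_quotient a n has_derivative (\<lambda>h. 0)) (at p)"
      by (rule has_derivative_transform_within_open[where s="{q. fst q < 0}"])
        (use 3 in \<open>auto simp: right_quotient_def intro!: open_Collect_less continuous_intros\<close>)
    then show ?thesis
      using 3 by (simp add: right_quotient_def[of _ _ p])
  qed
qed

lemma Ck_right_quotient: "3 * n + 3 * k < a \<Longrightarrow> Ck k (right_quotient a n)"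
proof (induction k arbitrary: n a)
  case 0
  then show ?case
    using continuous_right_quotient by (simp add: continuous_at_imp_continuous_on)
next
  case (Suc k)
  show ?case
  proof (rule Ck_SucI)
    show "(right_quotient a n has_derivative
     (\<lambda>h. fst h * (real a * right_quotient (a - 1) n p + (- 12 * real n) * right_quotient (a + 2) (Suc n) p)
        + snd h * ((- 54 * real n) * snd p * right_quotient a (Suc n) p))) (at p)" for p
      using has_derivative_right_quotient[of n a p] Suc.prems by simp
    show "Ck k (\<lambda>p. real a * right_quotient (a - 1) n p + (- 12 * real n) * right_quotient (a + 2) (Suc n) p)"
      "Ck k (\<lambda>p. (- 54 * real n) * snd p * right_quotient a (Suc n) p)"
      using Suc.prems by (intro Ck_add Ck_mult Ck_const Suc.IH smooth_Ck[OF smooth_snd]; simp)+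
  qed
qed


section \<open>Division by the discriminant\<close>

text \<open>Weierstrass division by \<open>\<Delta>\<close>, which is quadratic in the second coordinate; the remainder has
  coefficients that depend on the first coordinate only.\<close>

definition divides_with_remainder :: "nat \<Rightarrow> (plane \<Rightarrow> real) \<Rightarrow> bool" where
  "divides_with_remainder k F \<longleftrightarrow> (\<exists>Q r0 r1. Ck k Q \<and> Ck k r0 \<and> Ck k r1 \<and>
     (\<forall>u v. r0 (u, v) = r0 (u, 0)) \<and> (\<forall>u v. r1 (u, v) = r1 (u, 0)) \<and>
     (\<forall>p. F p = discr p * Q p + r0 p + snd p * r1 p))"

lemma divides_with_remainder_fst:
  assumes "Ck k r" "\<And>u v. r (u, v) = r (u, 0)"
  shows "divides_with_remainder k r"
  unfolding divides_with_remainder_def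
  using assms Ck_const[of k 0] by (intro exI[of _ "\<lambda>p. 0"] exI[of _ r]) auto

lemma divides_with_remainder_add:
  assumes "divides_with_remainder k F" "divides_with_remainder k H"
  shows "divides_with_remainder k (\<lambda>p. F p + H p)"
proof -
  obtain Q r0 r1 where F: "Ck k Q" "Ck k r0" "Ck k r1" "\<And>u v. r0 (u, v) = r0 (u, 0)"
    "\<And>u v. r1 (u, v) = r1 (u, 0)" "\<And>p. F p = discr p * Q p + r0 p + snd p * r1 p"
    using assms(1) unfolding divides_with_remainder_def by auto
  obtain Q' r0' r1' where H: "Ck k Q'" "Ck k r0'" "Ck k r1'" "\<And>u v. r0' (u, v) = r0' (u, 0)"
    "\<And>u v. r1' (u, v) = r1' (u, 0)" "\<And>p. H p = discr p * Q' p + r0' p + snd p * r1' p"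
    using assms(2) unfolding divides_with_remainder_def by auto
  show ?thesis
    unfolding divides_with_remainder_def
  proof (intro exI conjI)
    show "Ck k (\<lambda>p. Q p + Q' p)" "Ck k (\<lambda>p. r0 p + r0' p)" "Ck k (\<lambda>p. r1 p + r1' p)"
      by (intro Ck_add F H)+
    show "\<forall>u v. r0 (u, v) + r0' (u, v) = r0 (u, 0) + r0' (u, 0)"
      "\<forall>u v. r1 (u, v) + r1' (u, v) = r1 (u, 0) + r1' (u, 0)"
      using F(4,5) H(4,5) by metis+
    show "\<forall>p. F p + H p = discr p * (Q p + Q' p) + (r0 p + r0' p) + snd p * (r1 p + r1' p)"
      by (simp add: F(6) H(6) algebra_simps)
  qed
qed

text \<open>Multiplication by \<open>v\<close> turns the remainder term \<open>r\<^sub>1 v\<close> into \<open>r\<^sub>1 v\<^sup>2\<close>, which is reduced by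
  \<open>v\<^sup>2 = \<Delta> / 27 - 4 u ^ 3 / 27\<close>.\<close>

lemma divides_with_remainder_mult_snd:
  assumes "divides_with_remainder k F"
  shows "divides_with_remainder k (\<lambda>p. snd p * F p)"
proof -
  obtain Q r0 r1 where F: "Ck k Q" "Ck k r0" "Ck k r1" "\<And>u v. r0 (u, v) = r0 (u, 0)"
    "\<And>u v. r1 (u, v) = r1 (u, 0)" "\<And>p. F p = discr p * Q p + r0 p + snd p * r1 p"
    using assms unfolding divides_with_remainder_def by auto
  show ?thesis
    unfolding divides_with_remainder_def
  proof (intro exI conjI)
    show "Ck k (\<lambda>p. snd p * Q p + 1 / 27 * r1 p)" "Ck k (\<lambda>p. - 4 / 27 * fst p ^ 3 * r1 p)" "Ck k r0"
      by (intro Ck_add Ck_mult Ck_const Ck_power F smooth_Ck[OF smooth_fst] smooth_Ck[OF smooth_snd])+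
    show "\<forall>u v. - 4 / 27 * fst (u, v) ^ 3 * r1 (u, v) = - 4 / 27 * fst (u, 0 :: real) ^ 3 * r1 (u, 0)"
      "\<forall>u v. r0 (u, v) = r0 (u, 0)"
      using F(4,5) by simp_all
    show "\<forall>p. snd p * F p = discr p * (snd p * Q p + 1 / 27 * r1 p)
        + (- 4 / 27 * fst p ^ 3 * r1 p) + snd p * r0 p"
      by (simp add: F(6) discr_pair field_simps power2_eq_square)
  qed
qed

text \<open>A function of \<open>u\<close> and \<open>v\<^sup>2\<close> is compared with its value at \<open>v\<^sup>2 = - 4 u ^ 3 / 27\<close>, the place where \<open>\<Delta>\<close>
  vanishes. By Hadamard's lemma the difference is a multiple of \<open>v\<^sup>2 + 4 u ^ 3 / 27 = \<Delta> / 27\<close>.\<close>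

lemma divides_with_remainder_square:
  assumes "Ck (Suc k) E"
  shows "divides_with_remainder k (\<lambda>p. E (fst p, snd p ^ 2))"
proof -
  define c :: "plane \<Rightarrow> real" where "c p = - 4 / 27 * fst p ^ 3" for p
  define A :: "plane \<Rightarrow> plane" where "A p = (fst p, c p)" for p
  define B :: "plane \<Rightarrow> plane" where "B p = (0, snd p ^ 2 - c p)" for p
  define M where "M = segment_moment 0 A B (pd3 E)"
  have AB: "smooth_map A" "smooth_map B"
    unfolding smooth_map_def A_def B_def c_def fst_conv snd_conv by (intro conjI smooth_intros)+
  have c: "snd p ^ 2 - c p = discr p / 27" for p
    by (simp add: c_def discr_pair)
  show ?thesis
    unfolding divides_with_remainder_def
  proof (intro exI conjI)
    show "Ck k (\<lambda>p. 1 / 27 * M p)"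
      unfolding M_def by (intro Ck_mult Ck_const Ck_segment_moment AB Ck_Suc_pd[OF assms])
    show "Ck k (\<lambda>p. E (A p))"
      by (rule Ck_Suc_imp[OF Ck_compose[OF assms AB(1)]])
    show "Ck k (\<lambda>p. 0)" by (rule Ck_const)
    show "\<forall>p. E (fst p, snd p ^ 2) = discr p * (1 / 27 * M p) + E (A p) + snd p * 0"
    proof
      fix p
      have "(fst p, snd p ^ 2) = A p + B p"
        by (simp add: A_def B_def)
      then show "E (fst p, snd p ^ 2) = discr p * (1 / 27 * M p) + E (A p) + snd p * 0"
        using hadamard[OF assms AB, of p] by (simp add: M_def B_def c)
    qed
  qed (simp_all add: A_def c_def)
qed

text \<open>After splitting \<open>S\<close> into its parts even and odd in \<open>v\<close>, the product with a high power of \<open>v\<close> is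
  \<open>E (u, v\<^sup>2) + v * O (u, v\<^sup>2)\<close> with \<open>E\<close> and \<open>O\<close> of class \<open>C^(k+1)\<close>. Without the power of \<open>v\<close>, such \<open>E\<close>
  and \<open>O\<close> would have to be found by Whitney's theorem on even functions.\<close>

lemma divides_with_remainder_high_power:
  assumes "smooth S"
  shows "divides_with_remainder k (\<lambda>p. snd p ^ (2 * k + 4) * S p)"
proof -
  define reflect :: "plane \<Rightarrow> plane" where "reflect p = (fst p, - snd p)" for p
  define Se where "Se p = 1 / 2 * (S p + S (reflect p))" for p
  define So where "So p = 1 / 2 * (S p + - 1 * S (reflect p))" for p
  have "smooth_map reflect"
    unfolding smooth_map_def reflect_def fst_conv snd_conv by (intro conjI smooth_intros)
  note reflect = Ck_compose[OF smooth_Ck[OF assms] this]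
  have C: "Ck j Se" "Ck j So" for j
    unfolding Se_def[abs_def] So_def[abs_def]
    by (intro Ck_mult Ck_const Ck_add reflect smooth_Ck[OF assms])+
  have par: "Se (u, - v) = Se (u, v)" "So (u, - v) = - So (u, v)" for u v
    by (simp_all add: Se_def So_def reflect_def field_simps)
  have e: "snd p ^ (2 * k + 4) * Se p = half_power (2 * k + 4) Se (fst p, snd p ^ 2)" for p
    by (cases p; cases "0 \<le> snd p") (auto simp: half_power_def par)
  have o: "snd p ^ (2 * k + 4) * So p = snd p * half_power (2 * k + 3) So (fst p, snd p ^ 2)" for p
  proof -
    have "snd p ^ (2 * k + 4) = snd p * snd p ^ (2 * k + 3)"
      by (simp add: numeral_eq_Suc)
    then show ?thesis
      by (cases p; cases "0 \<le> snd p") (auto simp: half_power_def par abs_if power_minus_odd)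
  qed
  have "snd p ^ (2 * k + 4) * S p = half_power (2 * k + 4) Se (fst p, snd p ^ 2)
      + snd p * half_power (2 * k + 3) So (fst p, snd p ^ 2)" for p
    unfolding e[symmetric] o[symmetric] by (simp add: Se_def So_def field_simps)
  then have eq: "(\<lambda>p. snd p ^ (2 * k + 4) * S p) = (\<lambda>p. half_power (2 * k + 4) Se (fst p, snd p ^ 2)
      + snd p * half_power (2 * k + 3) So (fst p, snd p ^ 2))"
    by (rule ext)
  have "Ck (Suc k) (half_power (2 * k + 4) Se)" "Ck (Suc k) (half_power (2 * k + 3) So)"
    by (rule Ck_half_power[OF C(1)], simp) (rule Ck_half_power[OF C(2)], simp)
  then show ?thesis
    unfolding eq
    by (intro divides_with_remainder_add[OF divides_with_remainder_square
          divides_with_remainder_mult_snd[OF divides_with_remainder_square]])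
qed

text \<open>Descending induction on the power of \<open>v\<close> in front: by Hadamard's lemma in \<open>v\<close>, a smooth \<open>S\<close> differs
  from a function of \<open>u\<close> alone by \<open>v\<close> times a smooth function, so the power can be raised until
  \<open>divides_with_remainder_high_power\<close> applies.\<close>

lemma divides_with_remainder_smooth:
  assumes "smooth F"
  shows "divides_with_remainder k F"
proof -
  have "\<forall>S. smooth S \<longrightarrow> divides_with_remainder k (\<lambda>p. snd p ^ j * S p)" if "j \<le> 2 * k + 4" for j
    using that
  proof (induction rule: inc_induct)
    case base
    then show ?case using divides_with_remainder_high_power by blast
  next
    case (step j)
    show ?case
    proof (intro allI impI)
      fix S assume S: "smooth S"
      define A :: "plane \<Rightarrow> plane" where "A p = (fst p, 0)" for p
      define B :: "plane \<Rightarrow> plane" where "B p = (0, snd p)" for p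
      define S1 where "S1 = segment_moment 0 A B (pd3 S)"
      have AB: "smooth_map A" "smooth_map B"
        unfolding smooth_map_def A_def B_def fst_conv snd_conv by (intro conjI smooth_intros)+
      have "smooth S1"
        unfolding smooth_def S1_def using Ck_segment_moment[OF AB smooth_Ck] smooth_pd(2)[OF S] by blast
      have "S p = S (A p) + snd p * S1 p" for p
        using hadamard[OF smooth_Ck[OF S] AB, of p] by (simp add: A_def B_def S1_def)
      then have "snd p ^ j * S p = snd p ^ j * S (A p) + snd p ^ Suc j * S1 p" for p
        by (metis distrib_left mult.assoc mult.left_commute power_Suc)
      then have eq: "(\<lambda>p. snd p ^ j * S p) = (\<lambda>p. snd p ^ j * S (A p) + snd p ^ Suc j * S1 p)"
        by (rule ext)
      have "divides_with_remainder k (\<lambda>p. snd p ^ i * S (A p))" for i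
      proof (induction i)
        case 0
        have "Ck k (\<lambda>p. S (A p))"
          by (rule Ck_compose[OF smooth_Ck[OF S] AB(1)])
        then show ?case
          by (intro divides_with_remainder_fst) (simp_all add: A_def)
      next
        case (Suc i)
        then show ?case
          using divides_with_remainder_mult_snd[OF Suc] by (simp add: mult.assoc)
      qed
      then show "divides_with_remainder k (\<lambda>p. snd p ^ j * S p)"
        unfolding eq using step.IH \<open>smooth S1\<close> by (intro divides_with_remainder_add) auto
    qed
  qed
  from this[of 0] assms show ?thesis by simp
qed

lemma zero_on_closed_left_half_plane:
  assumes "continuous_on UNIV g" and "\<And>p :: plane. fst p < 0 \<Longrightarrow> g p = (0 :: real)" and "fst p \<le> 0"
  shows "g p = 0"
proof -
  define s where "s n = (fst p - inverse (real (Suc n)), snd p)" for n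
  have "s \<longlonglongrightarrow> (fst p - 0, snd p)"
    unfolding s_def by (intro tendsto_intros LIMSEQ_inverse_real_of_nat)
  then have "(\<lambda>n. g (s n)) \<longlonglongrightarrow> g p"
    using assms(1) continuous_on_tendsto_compose[OF assms(1)] by simp
  moreover have "fst (s n) < 0" for n
  proof -
    have "0 < inverse (real (Suc n))" by simp
    then show ?thesis
      using assms(3) unfolding s_def fst_conv by linarith
  qed
  then have "g (s n) = 0" for n using assms(2) by blast
  ultimately show ?thesis using LIMSEQ_unique[OF _ tendsto_const] by simp
qed

text \<open>For \<open>u < 0\<close> the cusp has the two points \<open>(u, \<plusminus> 2 t ^ 3)\<close> with \<open>u = - 3 t\<^sup>2\<close> above \<open>u\<close>, and a polynomial of
  degree at most one in \<open>v\<close> that vanishes at both is zero.\<close>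

lemma remainder_zero_left:
  assumes r: "\<And>u v. r0 (u, v) = r0 (u, 0)" "\<And>u v. r1 (u, v) = r1 (u, 0)"
    and z: "\<And>p. discr p = 0 \<Longrightarrow> r0 p + snd p * r1 p = (0 :: real)"
    and p: "fst p < 0"
  shows "r0 p + snd p * r1 p = 0"
proof -
  define t where "t = sqrt (- fst p / 3)"
  have "t > 0" using p by (simp add: t_def)
  have "t\<^sup>2 = - fst p / 3" using p by (simp add: t_def)
  then have "fst p = - 3 * t\<^sup>2" by simp
  then have "discr (fst p, 2 * t ^ 3) = 0" "discr (fst p, - 2 * t ^ 3) = 0"
    by (simp_all add: discr_def power_mult_distrib flip: power_mult)
  from z[OF this(1)] z[OF this(2)]
  have "r0 (fst p, 0) + 2 * t ^ 3 * r1 (fst p, 0) = 0" "r0 (fst p, 0) - 2 * t ^ 3 * r1 (fst p, 0) = 0"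
    using r[of "fst p" "2 * t ^ 3"] r[of "fst p" "- 2 * t ^ 3"] by simp_all
  then have "r0 (fst p, 0) = 0 \<and> t ^ 3 * r1 (fst p, 0) = 0" by linarith
  then show ?thesis
    using \<open>t > 0\<close> r[of "fst p" "snd p"] by simp
qed

text \<open>Each factor \<open>u\<close> is split off by Hadamard's lemma in the first coordinate. The new function is
  again zero for \<open>u < 0\<close>, since the segment from the line \<open>u = 0\<close> stays in the closed left half-plane,
  where the derivative vanishes.\<close>

lemma flat_factor:
  "Ck (M + k) R \<Longrightarrow> (\<And>p. fst p < 0 \<Longrightarrow> R p = 0) \<Longrightarrow>
     \<exists>g. Ck k g \<and> (\<forall>p. R p = fst p ^ M * g p)"
proof (induction M arbitrary: R)
  case 0
  then show ?case by auto
next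
  case (Suc M)
  have R: "Ck (Suc (M + k)) R" using Suc.prems(1) by simp
  note D = Ck_Suc_pd[OF R]
  define A :: "plane \<Rightarrow> plane" where "A p = (0, snd p)" for p
  define B :: "plane \<Rightarrow> plane" where "B p = (fst p, 0)" for p
  define R1 where "R1 = segment_moment 0 A B (pd2 R)"
  have AB: "smooth_map A" "smooth_map B"
    unfolding smooth_map_def A_def B_def fst_conv snd_conv by (intro conjI smooth_intros)+
  have "R (A p) = 0" for p
    by (rule zero_on_closed_left_half_plane[OF Ck_continuous_on[OF R] Suc.prems(2)])
      (simp_all add: A_def)
  then have eq: "R p = fst p * R1 p" for p
    using hadamard[OF R AB, of p] by (simp add: A_def B_def R1_def)
  have "pd2 R p = 0" if "fst p < 0" for p
  proof -
    have "((\<lambda>q. 0 :: real) has_derivative (\<lambda>h. 0)) (at p)" by simp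
    then have "(R has_derivative (\<lambda>h. 0)) (at p)"
      by (rule has_derivative_transform_within_open[where s="{q. fst q < 0}"])
        (use that Suc.prems(2) in \<open>auto intro!: open_Collect_less continuous_intros\<close>)
    from frechet_derivative_at[OF this] show ?thesis
      by (metis pd2_def)
  qed
  then have pd0: "pd2 R p = 0" if "fst p \<le> 0" for p
    using zero_on_closed_left_half_plane[OF Ck_continuous_on[OF D(1)]] that by blast
  have "R1 p = 0" if "fst p < 0" for p
  proof -
    have "R1 p = integral {0..1} (\<lambda>t :: real. 0)"
      unfolding R1_def segment_moment_def
    proof (rule integral_cong)
      fix t :: real assume "t \<in> {0..1}"
      then show "t ^ 0 * pd2 R (A p + t *\<^sub>R B p) = 0"
        using pd0[of "A p + t *\<^sub>R B p"] that by (simp add: A_def B_def mult_nonneg_nonpos)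
    qed
    then show ?thesis by simp
  qed
  moreover have "Ck (M + k) R1"
    unfolding R1_def by (rule Ck_segment_moment[OF AB D(1)])
  ultimately obtain g where "Ck k g" "\<forall>p. R1 p = fst p ^ M * g p"
    using Suc.IH by blast
  then show ?case using eq by (intro exI[of _ g]) simp
qed

text \<open>The points with \<open>\<Delta> < 0\<close> are dense in \<open>\<X>\<close>, so \<open>\<Delta>\<close> may be cancelled from an equation between
  continuous functions.\<close>

lemma cancel_discr_on_XX:
  assumes "continuous_on UNIV g" "continuous_on UNIV h"
    and "\<And>q. discr q < 0 \<Longrightarrow> discr q * g q = discr q * (h q :: real)" and "p \<in> XX"
  shows "g p = h p"
proof -
  have "g p - h p = 0"
  proof (rule continuous_constant_on_closure[where S="{p. discr p < 0}"])
    show "continuous_on (closure {p. discr p < 0}) (\<lambda>p. g p - h p)"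
      using assms(1,2) by (intro continuous_on_diff) (auto intro: continuous_on_subset)
    show "p \<in> closure {p. discr p < 0}"
      using XX_subset_closure assms(4) by blast
    show "g q - h q = 0" if "q \<in> {p. discr p < 0}" for q
      using assms(3)[of q] that by auto
  qed
  then show ?thesis by simp
qed

text \<open>The remainder \<open>R\<close> is zero for \<open>u < 0\<close>, hence of the form \<open>u ^ M * g\<close>, and
  \<open>R / \<Delta> = g * (u ^ M / \<Delta>)\<close> is of class \<open>C^k\<close> when \<open>M\<close> is large.\<close>

theorem division_by_discr:
  assumes F: "smooth F" and zero: "\<And>p. discr p = 0 \<Longrightarrow> F p = 0"
  obtains H where "smooth H" "\<And>p. F p = discr p * H p"
proof -
  have "\<exists>H. Ck k H \<and> (\<forall>p. F p = discr p * H p)" for k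
  proof -
    \<comment> \<open>least exponent for which \<open>Ck_right_quotient\<close> yields class \<open>C^k\<close> for \<open>u ^ M / \<Delta>\<close>\<close>
    define M where "M = 3 * k + 4"
    obtain Q r0 r1 where *: "Ck (M + k) Q" "Ck (M + k) r0" "Ck (M + k) r1"
      "\<And>u v. r0 (u, v) = r0 (u, 0)" "\<And>u v. r1 (u, v) = r1 (u, 0)"
      "\<And>p. F p = discr p * Q p + r0 p + snd p * r1 p"
      using divides_with_remainder_smooth[OF F, of "M + k"] unfolding divides_with_remainder_def by auto
    define R where "R p = r0 p + snd p * r1 p" for p
    have R: "Ck (M + k) R"
      unfolding R_def[abs_def] by (intro Ck_add Ck_mult * smooth_Ck[OF smooth_snd])
    have R0: "R p = 0" if "fst p < 0" for p
      unfolding R_def by (rule remainder_zero_left[where ?r0.0 = r0 and ?r1.0 = r1, OF *(4,5) _ that]) (use zero *(6) in fastforce)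
    obtain g where g: "Ck k g" "\<And>p. R p = fst p ^ M * g p"
      using flat_factor[OF R R0] by auto
    have "R p = discr p * (g p * right_quotient M 1 p)" for p
    proof (cases "0 < fst p")
      case True
      then show ?thesis
        using g(2)[of p] discr_pos[OF True] by (simp add: right_quotient_def)
    next
      case False
      then have "R p = 0"
        using R0[of p] g(2)[of p] by (cases "fst p = 0") (auto simp: M_def)
      then show ?thesis
        using False by (simp add: right_quotient_def)
    qed
    then have "F p = discr p * (Q p + g p * right_quotient M 1 p)" for p
      using *(6)[of p] R_def[of p] by (simp add: distrib_left)
    moreover have "Ck k (\<lambda>p. Q p + g p * right_quotient M 1 p)"
      by (intro Ck_add Ck_mult g Ck_right_quotient Ck_mono[OF *(1)]) (simp_all add: M_def)
    ultimately show ?thesis by blast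
  qed
  then obtain H where H: "\<And>k. Ck k (H k)" "\<And>k p. F p = discr p * H k p"
    by metis
  have "H k p = H 0 p" for k p
  proof (cases "discr p = 0")
    case True
    show ?thesis
      by (rule cancel_discr_on_XX[OF Ck_continuous_on[OF H(1)] Ck_continuous_on[OF H(1)]])
        (use True H(2) in \<open>simp_all add: XX_def flip: H(2)\<close>)
  next
    case False
    then show ?thesis
      using H(2)[of p k] H(2)[of p 0] by simp
  qed
  then have "H k = H 0" for k by (intro ext)
  then have "smooth (H 0)"
    using H(1) unfolding smooth_def by metis
  then show ?thesis
    using that H(2) by blast
qed


section \<open>Derivations in terms of partial derivatives\<close>

lemma hadamard_at:
  assumes F: "smooth F"
  obtains H1 H2 where "smooth H1" "smooth H2"
    "\<And>q. F q = F p + ((fst q - fst p) * H1 q + (snd q - snd p) * H2 q)"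
proof -
  define B :: "plane \<Rightarrow> plane" where "B q = (fst q - fst p, snd q - snd p)" for q
  have AB: "smooth_map (\<lambda>q. p)" "smooth_map B"
    unfolding smooth_map_def B_def fst_conv snd_conv by (intro conjI smooth_intros)+
  have "smooth (segment_moment 0 (\<lambda>q. p) B (pd2 F))" "smooth (segment_moment 0 (\<lambda>q. p) B (pd3 F))"
    unfolding smooth_def using Ck_segment_moment[OF AB smooth_Ck] smooth_pd[OF F] by blast+
  moreover have "F q = F p + ((fst q - fst p) * segment_moment 0 (\<lambda>q. p) B (pd2 F) q
      + (snd q - snd p) * segment_moment 0 (\<lambda>q. p) B (pd3 F) q)" for q
    using hadamard[OF smooth_Ck[OF F] AB, of q] by (simp add: B_def flip: minus_prod_def)
  ultimately show ?thesis using that by blast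
qed

lemma pd_fst_snd: "pd2 fst p = 1" "pd3 fst p = 0" "pd2 snd p = 0" "pd3 snd p = 1"
proof -
  have "frechet_derivative fst (at p) = fst" "frechet_derivative snd (at p) = snd" for p :: plane
    using frechet_derivative_at[OF has_derivative_fst[OF has_derivative_ident]]
      frechet_derivative_at[OF has_derivative_snd[OF has_derivative_ident]] by metis+
  then show "pd2 fst p = 1" "pd3 fst p = 0" "pd2 snd p = 0" "pd3 snd p = 1"
    by (simp_all add: pd2_def pd3_def)
qed

lemma pd_diff:
  assumes "smooth F" "smooth H"
  shows "pd2 (\<lambda>p. F p - H p) p = pd2 F p - pd2 H p" "pd3 (\<lambda>p. F p - H p) p = pd3 F p - pd3 H p"
proof -
  have "smooth (\<lambda>p. - 1 * H p)"
    by (intro smooth_mult smooth_const assms)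
  from pd_add[OF assms(1) this, of p]
  show "pd2 (\<lambda>p. F p - H p) p = pd2 F p - pd2 H p" "pd3 (\<lambda>p. F p - H p) p = pd3 F p - pd3 H p"
    using pd_mult[OF smooth_const assms(2), of "- 1" p] by (simp_all add: pd_const)
qed

lemmas pd_simps = pd_add pd_diff pd_mult pd_const pd_fst_snd

text \<open>In the expansion \<open>F = F p + x * H\<^sub>1 + y * H\<^sub>2\<close> about \<open>p\<close>, with \<open>x\<close> and \<open>y\<close> vanishing at \<open>p\<close>, both mixed
  partial derivatives at \<open>p\<close> are equal to \<open>\<partial>\<^sub>3 H\<^sub>1 + \<partial>\<^sub>2 H\<^sub>2\<close>.\<close>

lemma pd_commute:
  assumes F: "smooth F"
  shows "pd2 (pd3 F) p = pd3 (pd2 F) p"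
proof -
  obtain H1 H2 where H: "smooth H1" "smooth H2"
    "\<And>q. F q = F p + ((fst q - fst p) * H1 q + (snd q - snd p) * H2 q)"
    using hadamard_at[OF F, of p] by metis
  have F_eq: "F = (\<lambda>q. F p + ((fst q - fst p) * H1 q + (snd q - snd p) * H2 q))"
    using H(3) by blast
  have "pd2 F q = H1 q + ((fst q - fst p) * pd2 H1 q + (snd q - snd p) * pd2 H2 q)" for q
    by (subst F_eq) (simp add: pd_simps smooth_intros H(1,2))
  then have 2: "pd2 F = (\<lambda>q. H1 q + ((fst q - fst p) * pd2 H1 q + (snd q - snd p) * pd2 H2 q))"
    by (rule ext)
  have "pd3 F q = H2 q + ((fst q - fst p) * pd3 H1 q + (snd q - snd p) * pd3 H2 q)" for q
    by (subst F_eq) (simp add: pd_simps smooth_intros H(1,2))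
  then have 3: "pd3 F = (\<lambda>q. H2 q + ((fst q - fst p) * pd3 H1 q + (snd q - snd p) * pd3 H2 q))"
    by (rule ext)
  show ?thesis
    unfolding 2 3 by (simp add: pd_simps smooth_intros H(1,2))
qed

lemma vapp_derivation:
  "vapp X (a + b) = vapp X a + vapp X b" "vapp X (a - b) = vapp X a - vapp X b"
  "vapp X (- a) = - vapp X a" "vapp X (r *\<^sub>R a) = r *\<^sub>R vapp X a"
  "vapp X (a * b) = vapp X a * b + a * vapp X b"
  using is_vfieldD(1-5)[of "vapp X"] vapp[of X] by simp_all

lemma vapp_one: "vapp X 1 = 0" 
  using vapp_derivation(5)[of X 1 1] by simp

lemma vapp_zero: "vapp X 0 = 0"
  using vapp_derivation(4)[of X 0 0] by simp

lemma vapp_numeral: "vapp X (numeral n) = 0"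
  by (induction n) (simp_all only: numeral.simps vapp_one vapp_derivation add_0_left)

lemma cval_U [simp]: "p \<in> XX \<Longrightarrow> cval U2 p = fst p" "p \<in> XX \<Longrightarrow> cval U3 p = snd p"
  by (simp_all add: U2_def U3_def smooth_intros)

text \<open>Apply \<open>X\<close> to Hadamard's expansion of \<open>c\<close> about \<open>p\<close> and evaluate at \<open>p\<close>, where only the terms with \<open>X\<close> on the
  coordinates survive.\<close>

lemma vapp_eq_partials: "vapp X c = vapp X U2 * dd2 c + vapp X U3 * dd3 c"
proof (rule cinf_eqI)
  fix p assume p: "p \<in> XX"
  obtain F where F: "smooth F" "c = cinf_of F"
    using ex_cinf_of by metis
  obtain H1 H2 where H: "smooth H1" "smooth H2"
    "\<And>q. F q = F p + ((fst q - fst p) * H1 q + (snd q - snd p) * H2 q)"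
    using hadamard_at[OF F(1), of p] by metis
  have F_eq: "F = (\<lambda>q. F p + ((fst q - fst p) * H1 q + (snd q - snd p) * H2 q))"
    using H(3) by blast
  have "pd2 F p = H1 p" "pd3 F p = H2 p"
    using arg_cong[OF F_eq, of "\<lambda>F. pd2 F p"] arg_cong[OF F_eq, of "\<lambda>F. pd3 F p"]
    by (simp_all add: pd_simps smooth_intros H(1,2))
  moreover have "c = F p *\<^sub>R 1 + ((U2 - fst p *\<^sub>R 1) * cinf_of H1 + (U3 - snd p *\<^sub>R 1) * cinf_of H2)"
    by (rule cinf_eqI) (simp add: F H(1,2), rule H(3))
  then have "vapp X c = vapp X U2 * cinf_of H1 + (U2 - fst p *\<^sub>R 1) * vapp X (cinf_of H1)
       + (vapp X U3 * cinf_of H2 + (U3 - snd p *\<^sub>R 1) * vapp X (cinf_of H2))"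
    by (simp only: vapp_derivation vapp_one) simp
  ultimately show "cval (vapp X c) p = cval (vapp X U2 * dd2 c + vapp X U3 * dd3 c) p"
    using p by (simp add: F dd_cinf_of H smooth_intros)
qed


section \<open>Vector fields are free on the two generators\<close>

definition delta :: cinf where "delta = 4 * U2 ^ 3 + 27 * U3 ^ 2"

lemma cval_delta: "p \<in> XX \<Longrightarrow> cval delta p = discr p"
  by (simp add: delta_def discr_pair)

lemma discr_zero_in_XX: "discr p = 0 \<Longrightarrow> p \<in> XX"
  by (simp add: XX_def)

lemma delta_cancel: assumes "delta * a = delta * b" shows "a = b"
proof (rule cinf_eqI)
  fix p assume p: "p \<in> XX"
  obtain F where F: "smooth F" "a = cinf_of F"
    using ex_cinf_of by metis
  obtain H where H: "smooth H" "b = cinf_of H"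
    using ex_cinf_of by metis
  have "F p = H p"
  proof (rule cancel_discr_on_XX[OF smooth_continuous_on[OF F(1)] smooth_continuous_on[OF H(1)] _ p])
    fix q assume "discr q < 0"
    then have "q \<in> XX" by (simp add: XX_def)
    then show "discr q * F q = discr q * H q"
      using arg_cong[OF assms, of "\<lambda>a. cval a q"] by (simp add: F H cval_delta)
  qed
  then show "cval a p = cval b p"
    using p by (simp add: F H)
qed

lemma delta_dvd:
  assumes "a \<in> vanishing_ideal {p. discr p = 0}"
  shows "delta dvd a"
proof -
  obtain F where F: "smooth F" "a = cinf_of F"
    using ex_cinf_of by metis
  have "F p = 0" if "discr p = 0" for p
  proof -
    have "cval a p = 0"
      using assms that unfolding vanishing_ideal_def by blast
    then show ?thesis
      using discr_zero_in_XX[OF that] by (simp add: F)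
  qed
  then obtain H where H: "smooth H" "\<And>p. F p = discr p * H p"
    using division_by_discr[OF F(1)] by metis
  have "a = delta * cinf_of H"
    by (rule cinf_eqI) (simp add: F H cval_delta)
  then show ?thesis by simp
qed

lemma zeta_U:
  "vapp zeta1 U2 = 2 * U2" "vapp zeta1 U3 = 3 * U3"
  "vapp zeta2 U2 = - 9 * U3" "vapp zeta2 U3 = 2 * U2 ^ 2"
proof -
  have "dd2 U2 = 1" "dd3 U2 = 0" "dd2 U3 = 0" "dd3 U3 = 1"
    by (rule cinf_eqI; simp add: U2_def U3_def dd_cinf_of smooth_intros pd_fst_snd)+
  then show
    "vapp zeta1 U2 = 2 * U2" "vapp zeta1 U3 = 3 * U3"
    "vapp zeta2 U2 = - 9 * U3" "vapp zeta2 U3 = 2 * U2 ^ 2"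
    by (simp_all add: zeta1.rep_eq zeta2.rep_eq)
qed

lemma vapp_vf_scale [simp]: "vapp (a *\<^sub>A X) b = a * vapp X b"
  by (simp add: vf_scale.rep_eq)

lemma vfield_eq_iff: "X = Y \<longleftrightarrow> vapp X U2 = vapp Y U2 \<and> vapp X U3 = vapp Y U3"
  using vfield_eqI[of X Y] vapp_eq_partials[of X] vapp_eq_partials[of Y] by metis

text \<open>The first function is \<open>X \<Delta> / 6\<close>, and \<open>\<Delta>\<close> lies in the ideal of the cusp. At the point of the cusp with
  parameter \<open>t\<close> its value is \<open>18 t ^ 3 (t a + b)\<close>, where \<open>a\<close> and \<open>b\<close> are the values of \<open>X u\<^sup>2\<close> and
  \<open>X u\<^sup>3\<close>; hence \<open>t a + b = 0\<close>, where at \<open>t = 0\<close> the tangency to the origin is used.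
  The second function has the value \<open>- 6 t\<^sup>2 (t a + b)\<close>.\<close>

lemma tangency:
  "2 * U2 ^ 2 * vapp X U2 + 9 * U3 * vapp X U3 \<in> vanishing_ideal {p. discr p = 0}"
  "2 * U2 * vapp X U3 - 3 * U3 * vapp X U2 \<in> vanishing_ideal {p. discr p = 0}"
proof -
  have X: "is_vfield (vapp X)" using vapp[of X] by simp
  have sc: "{p. discr p = 0} \<in> stratum_closures" "{(0, 0)} \<in> stratum_closures"
    by (simp_all add: stratum_closures_def)
  have D0: "cval (2 * U2 ^ 2 * vapp X U2 + 9 * U3 * vapp X U3) p = 0" if "discr p = 0" for p
  proof -
    have "cval (vapp X delta) p = 0"
      by (rule is_vfieldD(6)[OF X sc(1)]) (use that discr_zero_in_XX in \<open>auto simp: cval_delta\<close>)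
    moreover have "vapp X delta = 6 * (2 * U2 ^ 2 * vapp X U2 + 9 * U3 * vapp X U3)"
      by (simp add: delta_def vapp_derivation vapp_numeral power2_eq_square power3_eq_cube algebra_simps)
    ultimately show ?thesis
      using discr_zero_in_XX[OF that] by (simp only: cval_simps cval_numeral) simp
  qed
  then show "2 * U2 ^ 2 * vapp X U2 + 9 * U3 * vapp X U3 \<in> vanishing_ideal {p. discr p = 0}"
    by (simp add: vanishing_ideal_def)
  show "2 * U2 * vapp X U3 - 3 * U3 * vapp X U2 \<in> vanishing_ideal {p. discr p = 0}"
    unfolding vanishing_ideal_def
  proof (intro CollectI ballI)
    fix p assume "p \<in> {p. discr p = 0}"
    then have p: "discr p = 0" by simp
    obtain t where t: "p = (- 3 * t\<^sup>2, 2 * t ^ 3)"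
      using cusp_param[OF p] by blast
    define x y where "x = cval (vapp X U2) p" and "y = cval (vapp X U3) p"
    have pX: "p \<in> XX" using p by (rule discr_zero_in_XX)
    have "2 * fst p ^ 2 * x + 9 * snd p * y = 0"
      using D0[OF p] pX by (simp add: x_def y_def)
    then have "18 * t ^ 3 * (t * x + y) = 0"
      by (simp add: t power2_eq_square power3_eq_cube algebra_simps)
    moreover have "y = 0" if "t = 0"
    proof -
      have "cval (vapp X U3) (0, 0) = 0"
        by (rule is_vfieldD(6)[OF X sc(2)]) (use zero_in_XX in auto)
      then show ?thesis using that by (simp add: y_def t)
    qed
    ultimately have "t * x + y = 0" by (cases "t = 0") auto
    then have y: "y = - t * x" by simp
    show "cval (2 * U2 * vapp X U3 - 3 * U3 * vapp X U2) p = 0"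
      using pX by (simp add: x_def[symmetric] y_def[symmetric] y)
        (simp add: t power2_eq_square power3_eq_cube)
  qed
qed

text \<open>Cramer's rule for \<open>X = a \<zeta>\<^sub>1 + b \<zeta>\<^sub>2\<close>; the coefficient matrix of \<open>\<zeta>\<^sub>1\<close> and \<open>\<zeta>\<^sub>2\<close> has determinant \<open>\<Delta>\<close>.\<close>

lemma ex_coordinates: "\<exists>a b. X = a *\<^sub>A zeta1 + b *\<^sub>A zeta2"
proof -
  obtain a where a: "2 * U2 ^ 2 * vapp X U2 + 9 * U3 * vapp X U3 = delta * a"
    using delta_dvd[OF tangency(1)[of X]] by (elim dvdE)
  obtain b where b: "2 * U2 * vapp X U3 - 3 * U3 * vapp X U2 = delta * b"
    using delta_dvd[OF tangency(2)[of X]] by (elim dvdE)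
  have "delta * vapp X U2 = 2 * U2 * (delta * a) - 9 * U3 * (delta * b)"
    unfolding a[symmetric] b[symmetric]
    by (simp add: delta_def power2_eq_square power3_eq_cube algebra_simps)
  then have 2: "vapp X U2 = a * (2 * U2) + b * (- 9 * U3)"
    by - (rule delta_cancel, simp add: algebra_simps)
  have "delta * vapp X U3 = 3 * U3 * (delta * a) + 2 * U2 ^ 2 * (delta * b)"
    unfolding a[symmetric] b[symmetric]
    by (simp add: delta_def power2_eq_square power3_eq_cube algebra_simps)
  then have 3: "vapp X U3 = a * (3 * U3) + b * (2 * U2 ^ 2)"
    by - (rule delta_cancel, simp add: algebra_simps)
  show ?thesis
    by (intro exI[of _ a] exI[of _ b]) (simp add: vfield_eq_iff zeta_U 2 3)
qed

lemma coordinates_unique: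
  assumes "a *\<^sub>A zeta1 + b *\<^sub>A zeta2 = c *\<^sub>A zeta1 + d *\<^sub>A zeta2"
  shows "a = c \<and> b = d"
proof -
  have 2: "a * (2 * U2) + b * (- 9 * U3) = c * (2 * U2) + d * (- 9 * U3)"
    using arg_cong[OF assms, of "\<lambda>X. vapp X U2"] by (simp add: zeta_U)
  have 3: "a * (3 * U3) + b * (2 * U2 ^ 2) = c * (3 * U3) + d * (2 * U2 ^ 2)"
    using arg_cong[OF assms, of "\<lambda>X. vapp X U3"] by (simp add: zeta_U)
  have "delta * x = 2 * U2 ^ 2 * (x * (2 * U2) + y * (- 9 * U3)) + 9 * U3 * (x * (3 * U3) + y * (2 * U2 ^ 2))"
    "delta * y = 2 * U2 * (x * (3 * U3) + y * (2 * U2 ^ 2)) - 3 * U3 * (x * (2 * U2) + y * (- 9 * U3))"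
    for x y
    by (simp_all add: delta_def power2_eq_square power3_eq_cube algebra_simps)
  then show ?thesis
    using delta_cancel 2 3 by metis
qed

definition coord :: "vfield \<Rightarrow> 2 \<Rightarrow> cinf" where
  "coord X = (SOME x. X = (\<Sum>i\<in>UNIV. x i *\<^sub>A zeta i))"

lemma zeta_simps: "zeta 1 = zeta1" "zeta 2 = zeta2"
  by (simp_all add: zeta_def)

lemma sum_coord: "X = (\<Sum>i\<in>UNIV. coord X i *\<^sub>A zeta i)"
proof -
  obtain a b where ab: "X = a *\<^sub>A zeta1 + b *\<^sub>A zeta2"
    using ex_coordinates by blast
  have "\<exists>x. X = (\<Sum>i\<in>UNIV. x i *\<^sub>A zeta i)"
    by (rule exI[of _ "\<lambda>i. if i = 1 then a else b"]) (simp add: sum_2 zeta_simps ab)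
  then show ?thesis
    unfolding coord_def by (rule someI_ex)
qed

lemma coord_eqI: "X = (\<Sum>i\<in>UNIV. x i *\<^sub>A zeta i) \<Longrightarrow> coord X = x"
proof
  fix i assume X: "X = (\<Sum>i\<in>UNIV. x i *\<^sub>A zeta i)"
  show "coord X i = x i"
    using coordinates_unique[of "coord X 1" "coord X 2" "x 1" "x 2"] sum_coord[of X] X exhaust_2[of i]
    by (auto simp: sum_2 zeta_simps)
qed

lemma coord_add: "coord (X + Y) i = coord X i + coord Y i"
  and coord_scale: "coord (a *\<^sub>A X) i = a * coord X i"
proof -
  interpret module vf_scale by (rule module_vf_scale)
  have "coord (X + Y) = (\<lambda>i. coord X i + coord Y i)"
    by (rule coord_eqI, subst (1) sum_coord[of X], subst (1) sum_coord[of Y])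
      (simp add: sum_2 scale_left_distrib)
  then show "coord (X + Y) i = coord X i + coord Y i" by simp
  have "coord (a *\<^sub>A X) = (\<lambda>i. a * coord X i)"
    by (rule coord_eqI, subst (1) sum_coord[of X]) (simp add: sum_2 scale_right_distrib)
  then show "coord (a *\<^sub>A X) i = a * coord X i" by simp
qed

lemma coord_zeta: "coord (zeta j) i = (if i = j then 1 else 0)"
proof -
  interpret module vf_scale by (rule module_vf_scale)
  have "coord (zeta j) = (\<lambda>i. if i = j then 1 else 0)"
    by (rule coord_eqI) (use exhaust_2[of j] in \<open>auto simp: sum_2\<close>)
  then show ?thesis by simp
qed

text \<open>The form in which generation by \<open>\<zeta>\<^sub>1\<close> and \<open>\<zeta>\<^sub>2\<close> is used to verify multilinear identities.\<close>

lemma vfield_induct [case_names zeta add scale]: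
  assumes "\<And>i. P (zeta i)" "\<And>X Y. P X \<Longrightarrow> P Y \<Longrightarrow> P (X + Y)" "\<And>a X. P X \<Longrightarrow> P (a *\<^sub>A X)"
  shows "P X"
proof -
  have "P (coord X 1 *\<^sub>A zeta 1 + coord X 2 *\<^sub>A zeta 2)"
    by (intro assms)
  then show ?thesis
    using sum_coord[of X] by (simp add: sum_2)
qed


section \<open>Forms and connections determined by the generators\<close>

lemma module_homD:
  assumes "module_hom vf_scale s T"
  shows "T (X + Y) = T X + T Y" "T (a *\<^sub>A X) = s a (T X)"
  using assms by (simp_all add: module_hom.add module_hom.scale)

lemma bilinear_eqI:
  assumes "\<And>X. module_hom vf_scale s (B X)" "\<And>Y. module_hom vf_scale s (\<lambda>X. B X Y)"
    and "\<And>X. module_hom vf_scale s (C X)" "\<And>Y. module_hom vf_scale s (\<lambda>X. C X Y)"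
    and "\<And>i j. B (zeta i) (zeta j) = C (zeta i) (zeta j)"
  shows "B X Y = C X Y"
proof (induction X rule: vfield_induct)
  case (zeta i)
  show ?case
    by (induction Y rule: vfield_induct) (simp_all add: assms(5) module_homD[OF assms(1)] module_homD[OF assms(3)])
qed (simp_all add: module_homD[OF assms(2)] module_homD[OF assms(4)])

lemma connectionD:
  assumes "connection N"
  shows "N (X + X') Y = N X Y + N X' Y" "N (a *\<^sub>A X) Y = a *\<^sub>A N X Y"
    "N X (Y + Y') = N X Y + N X Y'" "N X (a *\<^sub>A Y) = vapp X a *\<^sub>A Y + a *\<^sub>A N X Y"
    "N X (Y - Y') = N X Y - N X Y'" "N (X - X') Y = N X Y - N X' Y"
proof -
  have h: "module_hom vf_scale vf_scale (\<lambda>X. N X Y)" for Y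
    using assms by (auto simp: connection_def)
  have l: "linear (N X)" for X
    using assms by (auto simp: connection_def)
  show "N (X + X') Y = N X Y + N X' Y" "N (a *\<^sub>A X) Y = a *\<^sub>A N X Y"
    using module_homD[OF h] by blast+
  show "N (X - X') Y = N X Y - N X' Y"
    using module_hom.diff[OF h] by blast
  show "N X (Y + Y') = N X Y + N X Y'" "N X (Y - Y') = N X Y - N X Y'"
    using linear_add[OF l] linear_diff[OF l] by blast+
  show "N X (a *\<^sub>A Y) = vapp X a *\<^sub>A Y + a *\<^sub>A N X Y"
    using assms by (simp add: connection_def)
qed

lemma vapp_bracket [simp]: "vapp (bracket X Y) a = vapp X (vapp Y a) - vapp Y (vapp X a)"
  by (simp add: bracket.rep_eq)

lemma bracket_rules:
  "bracket (X + X') Y = bracket X Y + bracket X' Y"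
  "bracket X (Y + Y') = bracket X Y + bracket X Y'"
  "bracket (a *\<^sub>A X) Y = a *\<^sub>A bracket X Y - vapp Y a *\<^sub>A X"
  "bracket X (a *\<^sub>A Y) = a *\<^sub>A bracket X Y + vapp X a *\<^sub>A Y"
  by (rule vfield_eqI; simp add: vapp_derivation algebra_simps)+

lemma vf_scale_rules:
  "a *\<^sub>A (X + Y) = a *\<^sub>A X + a *\<^sub>A Y" "a *\<^sub>A (X - Y) = a *\<^sub>A X - a *\<^sub>A Y"
  "(a + b) *\<^sub>A X = a *\<^sub>A X + b *\<^sub>A X" "a *\<^sub>A b *\<^sub>A X = (a * b) *\<^sub>A X"
  "(0 :: cinf) *\<^sub>A X = 0" "a *\<^sub>A (0 :: vfield) = 0" "1 *\<^sub>A X = X"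
  "(a - b) *\<^sub>A X = a *\<^sub>A X - b *\<^sub>A X" "(- a) *\<^sub>A X = - (a *\<^sub>A X)"
  by (rule vfield_eqI; simp add: algebra_simps)+

lemma torsion_free_if_basis:
  assumes N: "connection N"
    and basis: "\<And>i j. N (zeta i) (zeta j) - N (zeta j) (zeta i) = bracket (zeta i) (zeta j)"
  shows "torsion_free N"
  unfolding torsion_free_def
proof (intro allI)
  fix X Y
  show "N X Y - N Y X = bracket X Y"
  proof (induction X rule: vfield_induct)
    case (zeta i)
    show ?case
    proof (induction Y rule: vfield_induct)
      case (zeta j)
      show ?case by (rule basis)
    next
      case (add Y Y')
      then show ?case by (simp add: connectionD[OF N] bracket_rules algebra_simps)
    next
      case (scale a Y)
      then show ?case
        by (simp add: connectionD[OF N] bracket_rules vf_scale_rules flip: scale)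
    qed
  next
    case (add X X')
    then show ?case by (simp add: connectionD[OF N] bracket_rules algebra_simps)
  next
    case (scale a X)
    then show ?case
      by (simp add: connectionD[OF N] bracket_rules vf_scale_rules flip: scale)
  qed
qed

lemma metric_connection_if_basis:
  assumes N: "connection N"
    and G: "\<And>X. module_hom vf_scale (*) (G X)" "\<And>Y. module_hom vf_scale (*) (\<lambda>X. G X Y)"
    and basis: "\<And>i j k. vapp (zeta i) (G (zeta j) (zeta k))
       = G (N (zeta i) (zeta j)) (zeta k) + G (zeta j) (N (zeta i) (zeta k))"
  shows "metric_connection G N"
  unfolding metric_connection_def
proof (intro allI)
  fix X Y Z
  note rules = connectionD[OF N] module_homD[OF G(1)] module_homD[OF G(2)] vapp_derivation
  show "vapp X (G Y Z) = G (N X Y) Z + G Y (N X Z)"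
  proof (induction X rule: vfield_induct)
    case (zeta i)
    show ?case
    proof (induction Y rule: vfield_induct)
      case (zeta j)
      show ?case
      proof (induction Z rule: vfield_induct)
        case (zeta k)
        show ?case by (rule basis)
      qed (simp_all add: rules algebra_simps)
    qed (simp_all add: rules algebra_simps)
  qed (simp_all add: rules algebra_simps)
qed

lemma curvature_antisym: "connection N \<Longrightarrow> curvature N X Y Z = - curvature N Y X Z"
proof -
  assume N: "connection N"
  have "bracket X Y = 0 - bracket Y X"
    by (rule vfield_eqI) simp
  then show ?thesis
    using connectionD(6)[OF N, of 0 "bracket Y X" Z] connectionD(6)[OF N, of 0 0 Z]
    by (simp add: curvature_def)
qed

lemma flat_if_basis:
  assumes N: "connection N"
    and basis: "curvature N zeta1 zeta2 zeta1 = 0" "curvature N zeta1 zeta2 zeta2 = 0"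
  shows "flat N"
  unfolding flat_def
proof (intro allI)
  fix X Y Z
  note rules = curvature_def connectionD[OF N] bracket_rules vf_scale_rules
  have self: "curvature N X X Z = 0" for X Z
    using curvature_antisym[OF N, of X X Z] by (simp flip: scaleR_2 add: eq_neg_iff_add_eq_0)
  have basis': "curvature N (zeta i) (zeta j) (zeta k) = 0" for i j k
    using exhaust_2[of i] exhaust_2[of j] exhaust_2[of k] basis self
      curvature_antisym[OF N, of zeta2 zeta1] by (auto simp: zeta_simps)
  have add1: "curvature N (X + X') Y Z = curvature N X Y Z + curvature N X' Y Z" for X X' Y Z
    by (simp add: rules)
  have add2: "curvature N X (Y + Y') Z = curvature N X Y Z + curvature N X Y' Z" for X Y Y' Z
    by (simp add: rules)
  have add3: "curvature N X Y (Z + Z') = curvature N X Y Z + curvature N X Y Z'" for X Y Z Z'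
    by (simp add: rules)
  have scale1: "curvature N (a *\<^sub>A X) Y Z = a *\<^sub>A curvature N X Y Z" for a X Y Z
    by (simp add: rules algebra_simps)
  have scale2: "curvature N X (a *\<^sub>A Y) Z = a *\<^sub>A curvature N X Y Z" for a X Y Z
    by (simp add: rules algebra_simps)
  have scale3: "curvature N X Y (a *\<^sub>A Z) = a *\<^sub>A curvature N X Y Z" for a X Y Z
    by (simp add: rules algebra_simps)
  show "curvature N X Y Z = 0"
  proof (induction X rule: vfield_induct)
    case (zeta i)
    show ?case
    proof (induction Y rule: vfield_induct)
      case (zeta j)
      show ?case
        by (induction Z rule: vfield_induct) (simp_all add: basis' add3 scale3 vf_scale_rules)
    qed (simp_all add: add2 scale2 vf_scale_rules)
  qed (simp_all add: add1 scale1 vf_scale_rules)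
qed

text \<open>The extension of prescribed values on the generators by linearity in \<open>X\<close> and the Leibniz rule in \<open>Y\<close>.\<close>

definition christoffel_connection :: "(2 \<Rightarrow> cinf ^ 2 ^ 2) \<Rightarrow> vfield \<Rightarrow> vfield \<Rightarrow> vfield" where
  "christoffel_connection C X Y = (\<Sum>k\<in>UNIV. (vapp X (coord Y k)
      + (\<Sum>i\<in>UNIV. \<Sum>j\<in>UNIV. coord X i * coord Y j * C i $ k $ j)) *\<^sub>A zeta k)"

lemma coord_scaleR: "coord (r *\<^sub>R X) i = r *\<^sub>R coord X i"
proof -
  have "r *\<^sub>R X = (r *\<^sub>R 1) *\<^sub>A X"
    by (rule vfield_eqI) simp
  then show ?thesis by (simp add: coord_scale)
qed

lemma connection_christoffel: "connection (christoffel_connection C)"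
proof -
  interpret module vf_scale by (rule module_vf_scale)
  have "module_hom vf_scale vf_scale (\<lambda>X. christoffel_connection C X Y)" for Y
    by unfold_locales
      (rule vfield_eqI; simp add: christoffel_connection_def coord_add coord_scale sum_2 algebra_simps)+
  moreover have "linear (christoffel_connection C X)" for X
    by (rule linearI; rule vfield_eqI;
      simp add: christoffel_connection_def coord_add coord_scaleR vapp_derivation sum_2 algebra_simps)
  moreover have "christoffel_connection C X (a *\<^sub>A Y) = vapp X a *\<^sub>A Y + a *\<^sub>A christoffel_connection C X Y" for X a Y
    by (subst (2) sum_coord[of Y])
      (rule vfield_eqI, simp add: christoffel_connection_def coord_scale vapp_derivation sum_2 algebra_simps)
  ultimately show ?thesis
    unfolding connection_def by blast
qed

lemma christoffel_connection_zeta: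
  "christoffel_connection C (zeta i) (zeta j) = (\<Sum>k\<in>UNIV. (C i $ k $ j) *\<^sub>A zeta k)"
  by (use exhaust_2[of i] exhaust_2[of j] in
      \<open>auto simp: christoffel_connection_def coord_zeta sum_2 vapp_one vapp_zero\<close>)

definition form_of :: "cinf ^ 2 ^ 2 \<Rightarrow> vfield \<Rightarrow> vfield \<Rightarrow> cinf" where
  "form_of g X Y = (\<Sum>i\<in>UNIV. \<Sum>j\<in>UNIV. g $ i $ j * (coord X i * coord Y j))"

lemma module_hom_form_of:
  "module_hom vf_scale (*) (form_of g X)" "module_hom vf_scale (*) (\<lambda>X. form_of g X Y)"
proof -
  interpret module vf_scale by (rule module_vf_scale)
  show "module_hom vf_scale (*) (form_of g X)" "module_hom vf_scale (*) (\<lambda>X. form_of g X Y)"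
    by (unfold_locales; simp add: form_of_def coord_add coord_scale sum_2 algebra_simps)+
qed

lemma form_of_zeta: "form_of g (zeta i) (zeta j) = g $ i $ j"
  using exhaust_2[of i] exhaust_2[of j] by (auto simp: form_of_def coord_zeta sum_2)

text \<open>If two fields define the same linear form, then Cramer's rule shows that the differences of their
  coordinates are annihilated by the Gram determinant \<open>\<Delta> c\<close>. Here \<open>\<Delta>\<close> cancels by density, and \<open>c\<close>
  because it has no zero on \<open>\<X>\<close>.\<close>

lemma semi_riemannian_form_of:
  assumes sym: "g $ 1 $ 2 = g $ 2 $ 1"
    and det: "g $ 1 $ 1 * g $ 2 $ 2 - g $ 1 $ 2 * g $ 2 $ 1 = delta * c"
    and c: "\<And>p. p \<in> XX \<Longrightarrow> cval c p \<noteq> 0"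
  shows "semi_riemannian_metric (form_of g)"
proof -
  have "inj (form_of g)"
  proof (rule injI)
    fix X Y assume eq: "form_of g X = form_of g Y"
    define x where "x i = coord X i - coord Y i" for i
    have 1: "g $ 1 $ j * x 1 + g $ 2 $ j * x 2 = 0" for j
      using fun_cong[OF eq, of "zeta j"] exhaust_2[of j]
      by (auto simp: form_of_def coord_zeta sum_2 x_def algebra_simps)
    have zero: "a = 0" if "(g $ 1 $ 1 * g $ 2 $ 2 - g $ 1 $ 2 * g $ 2 $ 1) * a = 0" for a
    proof -
      have "c * a = 0"
        by (rule delta_cancel) (use that in \<open>simp add: det mult.assoc\<close>)
      then have "cval c p * cval a p = 0" if "p \<in> XX" for p
        using that by (metis cval_simps(1,6))
      then show ?thesis
        using c by (intro cinf_eqI) auto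
    qed
    have "x 1 = 0"
    proof (rule zero)
      have "(g $ 1 $ 1 * g $ 2 $ 2 - g $ 1 $ 2 * g $ 2 $ 1) * x 1
        = g $ 2 $ 2 * (g $ 1 $ 1 * x 1 + g $ 2 $ 1 * x 2) - g $ 2 $ 1 * (g $ 1 $ 2 * x 1 + g $ 2 $ 2 * x 2)"
        by (simp add: algebra_simps)
      then show "(g $ 1 $ 1 * g $ 2 $ 2 - g $ 1 $ 2 * g $ 2 $ 1) * x 1 = 0"
        by (simp only: 1) simp
    qed
    moreover have "x 2 = 0"
    proof (rule zero)
      have "(g $ 1 $ 1 * g $ 2 $ 2 - g $ 1 $ 2 * g $ 2 $ 1) * x 2
        = g $ 1 $ 1 * (g $ 1 $ 2 * x 1 + g $ 2 $ 2 * x 2) - g $ 1 $ 2 * (g $ 1 $ 1 * x 1 + g $ 2 $ 1 * x 2)"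
        by (simp add: algebra_simps)
      then show "(g $ 1 $ 1 * g $ 2 $ 2 - g $ 1 $ 2 * g $ 2 $ 1) * x 2 = 0"
        by (simp only: 1) simp
    qed
    ultimately show "X = Y"
      using sum_coord[of X] sum_coord[of Y] by (simp add: x_def sum_2)
  qed
  moreover have "form_of g X Y = form_of g Y X" for X Y
    using sym by (simp add: form_of_def sum_2 algebra_simps)
  ultimately show ?thesis
    unfolding semi_riemannian_metric_def using module_hom_form_of by blast
qed


section \<open>The metric and its Levi-Civita connection\<close>

text \<open>Differentiate \<open>\<partial>\<^sub>i f = f * \<partial>\<^sub>i (log f)\<close> once more and use the symmetry of the second derivatives of \<open>f\<close>.
  This avoids the logarithm itself, for which the sign of \<open>f\<close> would matter.\<close>

lemma dlog_closed:
  assumes f: "smooth f" "\<And>p. f p \<noteq> 0"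
  shows "pd3 (dlog2 f) p = pd2 (dlog3 f) p"
proof -
  note d = smooth_dlog[OF f]
  have "pd2 f = (\<lambda>q. f q * dlog2 f q)" "pd3 f = (\<lambda>q. f q * dlog3 f q)"
    using f(2) by (auto simp: dlog2_def dlog3_def)
  then have "pd3 (pd2 f) p = f p * pd3 (dlog2 f) p + pd3 f p * dlog2 f p"
    "pd2 (pd3 f) p = f p * pd2 (dlog3 f) p + pd2 f p * dlog3 f p"
    using pd_mult[OF f(1) d(1), of p] pd_mult[OF f(1) d(2), of p] by metis+
  then have "f p * pd3 (dlog2 f) p + pd3 f p * dlog2 f p = f p * pd2 (dlog3 f) p + pd2 f p * dlog3 f p"
    using pd_commute[OF f(1)] by simp
  moreover have "pd3 f p * dlog2 f p = pd2 f p * dlog3 f p"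
    by (simp add: dlog2_def dlog3_def)
  ultimately show ?thesis
    using f(2)[of p] by simp
qed

definition gram :: "(plane \<Rightarrow> real) \<Rightarrow> cinf ^ 2 ^ 2" where
  "gram f = vector [vector [- U2 * cinf_of f, (9 / 2) *\<^sub>R (U3 * cinf_of f)],
                    vector [(9 / 2) *\<^sub>R (U3 * cinf_of f), 3 * U2 ^ 2 * cinf_of f]]"

lemma is_metric_of_gram:
  assumes "smooth f" "\<And>p. f p \<noteq> 0"
  shows "is_metric_of f (form_of (gram f))"
proof -
  have "semi_riemannian_metric (form_of (gram f))"
  proof (rule semi_riemannian_form_of)
    show "gram f $ 1 $ 1 * gram f $ 2 $ 2 - gram f $ 1 $ 2 * gram f $ 2 $ 1
        = delta * (- (3 / 4) *\<^sub>R cinf_of f ^ 2)"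
      by (rule cinf_eqI)
        (simp add: gram_def vector_2 cval_delta discr_pair power2_eq_square power3_eq_cube algebra_simps)
    show "cval (- (3 / 4) *\<^sub>R cinf_of f ^ 2) p \<noteq> 0" if "p \<in> XX" for p
      using that assms by simp
  qed (simp add: gram_def vector_2)
  then show ?thesis
    using form_of_zeta[of "gram f" 1 1] form_of_zeta[of "gram f" 1 2]
      form_of_zeta[of "gram f" 2 1] form_of_zeta[of "gram f" 2 2]
    by (simp add: is_metric_of_def zeta_simps gram_def vector_2)
qed

lemma is_metric_of_basis:
  assumes "is_metric_of f G"
  shows "G (zeta i) (zeta j) = gram f $ i $ j"
  using assms exhaust_2[of i] exhaust_2[of j]
  by (auto simp: is_metric_of_def zeta_simps gram_def vector_2)

lemma is_metric_of_unique:
  assumes "is_metric_of f G" "is_metric_of f G'"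
  shows "G = G'"
proof (intro ext)
  fix X Y
  have "module_hom vf_scale (*) (G X)" "module_hom vf_scale (*) (\<lambda>X. G X Y)"
    "module_hom vf_scale (*) (G' X)" "module_hom vf_scale (*) (\<lambda>X. G' X Y)" for X Y
    using assms by (auto simp: is_metric_of_def semi_riemannian_metric_def)
  then show "G X Y = G' X Y"
    by (rule bilinear_eqI) (simp add: is_metric_of_basis[OF assms(1)] is_metric_of_basis[OF assms(2)])
qed

definition christoffel_symbols :: "cinf \<Rightarrow> cinf \<Rightarrow> 2 \<Rightarrow> cinf ^ 2 ^ 2" where
  "christoffel_symbols l2 l3 i =
     (if i = 1 then
        vector [vector [1 + U2 * l2 + 3 * U3 * l3, U2 ^ 2 * l3],
                vector [(1 / 3) *\<^sub>R (U2 * l3),     2 + U2 * l2]]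
      else
        vector [vector [U2 ^ 2 * l3, 3 * U2 * (- 2 + U2 * l2)],
                vector [1 + U2 * l2, - 9 * U3 * l2 + U2 ^ 2 * l3]])"

lemma bracket_zeta: "bracket zeta1 zeta2 = zeta2"
  by (simp add: vfield_eq_iff zeta_U vapp_derivation vapp_numeral power2_eq_square algebra_simps)

lemma bracket_antisym: "bracket X X = 0" "bracket X Y = - bracket Y X"
  by (rule vfield_eqI; simp)+

lemma vapp_zeta:
  "vapp zeta1 a = 2 * U2 * dd2 a + 3 * U3 * dd3 a" "vapp zeta2 a = - 9 * U3 * dd2 a + 2 * U2 ^ 2 * dd3 a"
  by (simp_all add: zeta1.rep_eq zeta2.rep_eq)

text \<open>The usual coordinate formula; its last term comes from \<open>[\<zeta>\<^sub>1, \<zeta>\<^sub>2] = \<zeta>\<^sub>2\<close>.\<close>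

lemma curvature_coefficient:
  assumes N: "connection N"
    and C: "\<And>i j. N (zeta i) (zeta j) = (\<Sum>k\<in>UNIV. (C i $ k $ j) *\<^sub>A zeta k)"
  shows "curvature N zeta1 zeta2 (zeta j) = (\<Sum>k\<in>UNIV.
     (vapp zeta1 (C 2 $ k $ j) - vapp zeta2 (C 1 $ k $ j)
      + (C 1 $ k $ 1 * C 2 $ 1 $ j + C 1 $ k $ 2 * C 2 $ 2 $ j)
      - (C 2 $ k $ 1 * C 1 $ 1 $ j + C 2 $ k $ 2 * C 1 $ 2 $ j)
      - C 2 $ k $ j) *\<^sub>A zeta k)"
proof -
  note C' = C[of 1, unfolded zeta_simps] C[of 2, unfolded zeta_simps]
  note C'' = C'(1)[of 1] C'(1)[of 2] C'(2)[of 1] C'(2)[of 2]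
  have "curvature N zeta1 zeta2 (zeta j) = N zeta1 (\<Sum>k\<in>UNIV. (C 2 $ k $ j) *\<^sub>A zeta k)
     - N zeta2 (\<Sum>k\<in>UNIV. (C 1 $ k $ j) *\<^sub>A zeta k) - (\<Sum>k\<in>UNIV. (C 2 $ k $ j) *\<^sub>A zeta k)"
    by (simp only: curvature_def bracket_zeta C')
  also have "\<dots> = (\<Sum>k\<in>UNIV.
     (vapp zeta1 (C 2 $ k $ j) - vapp zeta2 (C 1 $ k $ j)
      + (C 1 $ k $ 1 * C 2 $ 1 $ j + C 1 $ k $ 2 * C 2 $ 2 $ j)
      - (C 2 $ k $ 1 * C 1 $ 1 $ j + C 2 $ k $ 2 * C 1 $ 2 $ j)
      - C 2 $ k $ j) *\<^sub>A zeta k)"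
    by (rule vfield_eqI)
      (simp add: sum_2 connectionD[OF N] C''[unfolded zeta_simps] zeta_simps algebra_simps)
  finally show ?thesis .
qed

theorem theorem11p4:
  fixes f :: "plane \<Rightarrow> real" and l2 l3 chi lam :: cinf
  assumes f_smooth: "smooth f"
    and f_nonzero: "\<And>p. f p \<noteq> 0"
    and l2: "l2 = cinf_of (dlog2 f)"
    and l3: "l3 = cinf_of (dlog3 f)"
    and chi: "chi = cinf_of (pd3 (dlog3 f))"
    and lam: "lam = l2 + 3 * U3 * cinf_of (pd2 (dlog3 f)) + U2 * cinf_of (pd2 (dlog2 f))"
  shows "(\<exists>!G. is_metric_of f G) \<and>
    (\<forall>G. is_metric_of f G \<longrightarrow>
      (\<exists>N. levi_civita G N \<and>
        is_christoffel_matrix N 1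
          (vector [vector [1 + U2 * l2 + 3 * U3 * l3, U2 ^ 2 * l3],
                   vector [(1 / 3) *\<^sub>R (U2 * l3),     2 + U2 * l2]]) \<and>
        is_christoffel_matrix N 2
          (vector [vector [U2 ^ 2 * l3, 3 * U2 * (- 2 + U2 * l2)],
                   vector [1 + U2 * l2, - 9 * U3 * l2 + U2 ^ 2 * l3]]) \<and>
        curvature N zeta1 zeta2 zeta1 =
          (- 3 * U2 ^ 2 * U3 * chi + 9 * U3 * lam) *\<^sub>A zeta1
          + (- ((2 / 3) *\<^sub>R (U2 ^ 3 * chi)) + 2 * U2 * lam) *\<^sub>A zeta2 \<and>
        curvature N zeta1 zeta2 zeta2 =
          (- 2 * U2 ^ 4 * chi + 6 * U2 ^ 2 * lam) *\<^sub>A zeta1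
          + (3 * U2 ^ 2 * U3 * chi - 9 * U3 * lam) *\<^sub>A zeta2 \<and>
        (f constant_on UNIV \<longrightarrow> flat N)))"
proof (intro conjI allI impI)
  show "\<exists>!G. is_metric_of f G"
    using is_metric_of_gram[OF f_smooth f_nonzero] is_metric_of_unique by blast
next
  fix G assume G: "is_metric_of f G"
  define C where "C = christoffel_symbols l2 l3"
  define N where "N = christoffel_connection C"
  have N: "connection N"
    unfolding N_def by (rule connection_christoffel)
  have NC: "N (zeta i) (zeta j) = (\<Sum>k\<in>UNIV. (C i $ k $ j) *\<^sub>A zeta k)" for i j
    unfolding N_def by (rule christoffel_connection_zeta)
  note dlog = smooth_dlog[OF f_smooth f_nonzero]
  have C1: "C 1 $ 1 $ 1 = 1 + U2 * l2 + 3 * U3 * l3" "C 1 $ 1 $ 2 = U2 ^ 2 * l3"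
    "C 1 $ 2 $ 1 = (1 / 3) *\<^sub>R (U2 * l3)" "C 1 $ 2 $ 2 = 2 + U2 * l2"
    and C2: "C 2 $ 1 $ 1 = U2 ^ 2 * l3" "C 2 $ 1 $ 2 = 3 * U2 * (- 2 + U2 * l2)"
    "C 2 $ 2 $ 1 = 1 + U2 * l2" "C 2 $ 2 $ 2 = - 9 * U3 * l2 + U2 ^ 2 * l3"
    by (simp_all add: C_def christoffel_symbols_def vector_2)
  define l22 l23 where "l22 = cinf_of (pd2 (dlog2 f))" and "l23 = cinf_of (pd2 (dlog3 f))"
  have lam': "lam = l2 + 3 * U3 * l23 + U2 * l22"
    by (simp add: lam l22_def l23_def)
  have "cinf_of (pd3 (dlog2 f)) = l23"
    by (rule cinf_eqI) (simp add: l23_def dlog smooth_pd dlog_closed[OF f_smooth f_nonzero])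
  then have dd: "dd2 l2 = l22" "dd3 l2 = l23" "dd2 l3 = l23" "dd3 l3 = chi"
    by (simp_all add: l2 l3 chi dd_cinf_of dlog l22_def l23_def)
  have ddf: "dd2 (cinf_of f) = cinf_of f * l2" "dd3 (cinf_of f) = cinf_of f * l3"
    by (rule cinf_eqI; simp add: dd_cinf_of f_smooth smooth_pd dlog l2 l3;
      simp add: dlog2_def dlog3_def f_nonzero)+
  have Z: "vapp zeta1 l2 = 2 * U2 * l22 + 3 * U3 * l23" "vapp zeta1 l3 = 2 * U2 * l23 + 3 * U3 * chi"
    "vapp zeta2 l2 = - 9 * U3 * l22 + 2 * U2 ^ 2 * l23" "vapp zeta2 l3 = - 9 * U3 * l23 + 2 * U2 ^ 2 * chi"
    "vapp zeta1 (cinf_of f) = (2 * U2 * l2 + 3 * U3 * l3) * cinf_of f"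
    "vapp zeta2 (cinf_of f) = (- 9 * U3 * l2 + 2 * U2 ^ 2 * l3) * cinf_of f"
    by (simp_all add: vapp_zeta dd ddf algebra_simps)
  \<comment> \<open>with the action of \<open>\<zeta>\<^sub>1\<close> and \<open>\<zeta>\<^sub>2\<close> on all entries of the Gram and Christoffel matrices
      known, the remaining claims are polynomial identities\<close>
  note rules = vapp_derivation vapp_one vapp_numeral power2_eq_square zeta_U Z
  have "metric_connection G N"
  proof (rule metric_connection_if_basis[OF N])
    have GX: "module_hom vf_scale (*) (G X)" and GY: "module_hom vf_scale (*) (\<lambda>X. G X Y)" for X Y
      using G by (auto simp: is_metric_of_def semi_riemannian_metric_def)
    then show "module_hom vf_scale (*) (G X)" "module_hom vf_scale (*) (\<lambda>X. G X Y)" for X Y .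
    fix i j k :: 2
    have "vapp (zeta i) (gram f $ j $ k) = (\<Sum>l\<in>UNIV. C i $ l $ j * gram f $ l $ k)
        + (\<Sum>l\<in>UNIV. C i $ l $ k * gram f $ j $ l)"
      by (rule cinf_eqI)
        (use exhaust_2[of i] exhaust_2[of j] exhaust_2[of k] in
          \<open>auto simp: sum_2 zeta_simps gram_def vector_2 C1 C2 rules field_simps\<close>)
    then show "vapp (zeta i) (G (zeta j) (zeta k))
       = G (N (zeta i) (zeta j)) (zeta k) + G (zeta j) (N (zeta i) (zeta k))"
      by (simp add: NC sum_2 module_homD[OF GX] module_homD[OF GY] is_metric_of_basis[OF G])
  qed
  moreover have "torsion_free N"
  proof (rule torsion_free_if_basis[OF N])
    have "N zeta1 zeta2 - N zeta2 zeta1 = zeta2"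
      using NC[of 1 2] NC[of 2 1]
      by (intro vfield_eqI) (simp add: zeta_simps sum_2 C1 C2 algebra_simps)
    then have 12: "N zeta1 zeta2 = N zeta2 zeta1 + zeta2"
      by (simp add: diff_eq_eq)
    fix i j :: 2
    show "N (zeta i) (zeta j) - N (zeta j) (zeta i) = bracket (zeta i) (zeta j)"
      using exhaust_2[of i] exhaust_2[of j]
      by (auto simp: zeta_simps 12 bracket_zeta bracket_antisym(1) bracket_antisym(2)[of zeta2 zeta1])
  qed
  ultimately have "levi_civita G N"
    using N by (simp add: levi_civita_def)
  moreover have "is_christoffel_matrix N 1 (C 1)" "is_christoffel_matrix N 2 (C 2)"
    using NC by (simp_all add: is_christoffel_matrix_def)
  moreover have R1: "curvature N zeta1 zeta2 zeta1 =
          (- 3 * U2 ^ 2 * U3 * chi + 9 * U3 * lam) *\<^sub>A zeta1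
          + (- ((2 / 3) *\<^sub>R (U2 ^ 3 * chi)) + 2 * U2 * lam) *\<^sub>A zeta2"
  proof -
    have 
      "vapp zeta1 (C 2 $ 1 $ 1) - vapp zeta2 (C 1 $ 1 $ 1)
      + (C 1 $ 1 $ 1 * C 2 $ 1 $ 1 + C 1 $ 1 $ 2 * C 2 $ 2 $ 1)
      - (C 2 $ 1 $ 1 * C 1 $ 1 $ 1 + C 2 $ 1 $ 2 * C 1 $ 2 $ 1)
      - C 2 $ 1 $ 1 = - 3 * U2 ^ 2 * U3 * chi + 9 * U3 * lam"
      "vapp zeta1 (C 2 $ 2 $ 1) - vapp zeta2 (C 1 $ 2 $ 1)
      + (C 1 $ 2 $ 1 * C 2 $ 1 $ 1 + C 1 $ 2 $ 2 * C 2 $ 2 $ 1)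
      - (C 2 $ 2 $ 1 * C 1 $ 1 $ 1 + C 2 $ 2 $ 2 * C 1 $ 2 $ 1)
      - C 2 $ 2 $ 1 = - ((2 / 3) *\<^sub>R (U2 ^ 3 * chi)) + 2 * U2 * lam"
      by (rule cinf_eqI; simp add: C1 C2 rules lam' power3_eq_cube; simp add: field_simps)+
    then show ?thesis
      using curvature_coefficient[OF N NC, of 1] by (simp add: sum_2 zeta_simps)
  qed
  moreover have R2: "curvature N zeta1 zeta2 zeta2 =
          (- 2 * U2 ^ 4 * chi + 6 * U2 ^ 2 * lam) *\<^sub>A zeta1
          + (3 * U2 ^ 2 * U3 * chi - 9 * U3 * lam) *\<^sub>A zeta2"
  proof -
    have 
      "vapp zeta1 (C 2 $ 1 $ 2) - vapp zeta2 (C 1 $ 1 $ 2)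
      + (C 1 $ 1 $ 1 * C 2 $ 1 $ 2 + C 1 $ 1 $ 2 * C 2 $ 2 $ 2)
      - (C 2 $ 1 $ 1 * C 1 $ 1 $ 2 + C 2 $ 1 $ 2 * C 1 $ 2 $ 2)
      - C 2 $ 1 $ 2 = - 2 * U2 ^ 4 * chi + 6 * U2 ^ 2 * lam"
      "vapp zeta1 (C 2 $ 2 $ 2) - vapp zeta2 (C 1 $ 2 $ 2)
      + (C 1 $ 2 $ 1 * C 2 $ 1 $ 2 + C 1 $ 2 $ 2 * C 2 $ 2 $ 2)
      - (C 2 $ 2 $ 1 * C 1 $ 1 $ 2 + C 2 $ 2 $ 2 * C 1 $ 2 $ 2)
      - C 2 $ 2 $ 2 = 3 * U2 ^ 2 * U3 * chi - 9 * U3 * lam"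
      by (rule cinf_eqI; simp add: C1 C2 rules lam' power4_eq_xxxx; simp add: algebra_simps)+
    then show ?thesis
      using curvature_coefficient[OF N NC, of 2] by (simp add: sum_2 zeta_simps)
  qed
  moreover have "flat N" if const: "f constant_on UNIV"
  proof -
    obtain c where "f p = c" for p
      using const unfolding constant_on_def by blast
    then have c: "f = (\<lambda>p. c)"
      by (rule ext)
    have "dlog2 f = (\<lambda>p. 0)" "dlog3 f = (\<lambda>p. 0)"
      by (auto simp: dlog2_def dlog3_def c pd_const)
    then have "l2 = 0" "chi = 0" "l22 = 0" "l23 = 0"
      unfolding l2 chi l22_def l23_def
      by (auto intro!: cinf_eqI simp: pd_const[abs_def] smooth_const)
    then show ?thesis
      using R1 R2 by (intro flat_if_basis[OF N]) (simp_all add: lam' vf_scale_rules)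
  qed
  ultimately show "\<exists>N. levi_civita G N \<and>
        is_christoffel_matrix N 1
          (vector [vector [1 + U2 * l2 + 3 * U3 * l3, U2 ^ 2 * l3],
                   vector [(1 / 3) *\<^sub>R (U2 * l3),     2 + U2 * l2]]) \<and>
        is_christoffel_matrix N 2
          (vector [vector [U2 ^ 2 * l3, 3 * U2 * (- 2 + U2 * l2)],
                   vector [1 + U2 * l2, - 9 * U3 * l2 + U2 ^ 2 * l3]]) \<and>
        curvature N zeta1 zeta2 zeta1 =
          (- 3 * U2 ^ 2 * U3 * chi + 9 * U3 * lam) *\<^sub>A zeta1
          + (- ((2 / 3) *\<^sub>R (U2 ^ 3 * chi)) + 2 * U2 * lam) *\<^sub>A zeta2 \<and>
        curvature N zeta1 zeta2 zeta2 =
          (- 2 * U2 ^ 4 * chi + 6 * U2 ^ 2 * lam) *\<^sub>A zeta1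
          + (3 * U2 ^ 2 * U3 * chi - 9 * U3 * lam) *\<^sub>A zeta2 \<and>
        (f constant_on UNIV \<longrightarrow> flat N)"
    by (intro exI[of _ N]) (simp add: C_def christoffel_symbols_def)
qed

end
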